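(* Let $(V,\omega)$ be a simple VOA of strong CFT type over $\mathbb{R}$. Suppose that the invariant bilinear form on $V$ is positive-definite. Then $$CV=\left\{\tfrac12 a(1)a+a+\omega+Tb\ \middle|\ a,b\in J_1(V)\right\}$$ and $\mathrm{Aut}\,V=\mathrm{Aut}^{-}V\rtimes\mathrm{Aut}_\omega V$. In particular, if $J_1(V)=0$, then $CV=\{\omega\}$ and $\mathrm{Aut}\,V=\mathrm{Aut}_\omega V$.
   Context: For a vertex algebra $V$ over $\mathbb{R}$ with vacuum vector $\mathbf{1}$, $a(n)b$ denotes the $n$-th product ($n\in\mathbb{Z}$), $a(n)\in\mathrm{End}\,V$, and $Ta=a(-2)\mathbf{1}$. A $\mathbb{Z}$-graded vertex algebra is a vertex algebra $V=\bigoplus_{n\in\mathbb{Z}}V_n$ with $V_n(k)V_m\subset V_{n+m-k-1}$ and $\mathbf{1}\in V_0$. A $\mathbb{Z}$-graded conformal vertex algebra $(V,\omega)$ is a $\mathbb{Z}$-graded vertex algebra with a distinguished $\omega\in V_2$ such that the operators $L(n)=\omega(n+1)$ satisfy $[L(n),L(m)]=(n-m)L(n+m)+\frac{1}{12}\delta_{n+m,0}(n^3-n)c$ for some constant $c\in\mathbb{R}$, $L(0)v=nv$ for $v\in V_n$, and $L(-1)=T$. It is a VOA of CFT type if $V=\bigoplus_{n\in\mathbb{N}}V_n$ (with $\mathbb{N}=\{0,1,2,\dots\}$), $\dim V_n<\infty$ for all $n$, and $V_0=\mathbb{R}\mathbf{1}$. It is a VOA of strong CFT type if moreover $L(1)V_1=0$.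 Simple means that $V$ has no nontrivial proper ideals. A simple VOA of strong CFT type carries a nonzero invariant bilinear form $(\,,\,)$, unique up to scalar and normalized by $(\mathbf{1},\mathbf{1})=1$; invariance means $(Y(a,z)u,v)=(u,Y(e^{zL(1)}(-z^{-2})^{L(0)}a,z^{-1})v)$, where $Y(a,z)=\sum_n a(n)z^{-n-1}$. $CV$ is the set of conformal vectors of $V$, i.e. of $a\in V$ such that $(V,a)$, with grading $V=\bigoplus_{n\in\mathbb{Z}}V_n^a$, $V_n^a=\{v\in V\mid a(1)v=nv\}$, is a $\mathbb{Z}$-graded conformal vertex algebra. $\mathrm{Aut}\,V$ is the group of vertex algebra automorphisms (linear isomorphisms $f$ with $f(a(n)b)=f(a)(n)f(b)$ for all $a,b,n$ and $f(\mathbf{1})=\mathbf{1}$); $\mathrm{Aut}_\omega V=\{f\in\mathrm{Aut}\,V\mid f(\omega)=\omega\}$; with $\mathrm{pr}_n:V\to V_n$ the canonical projection, $\mathrm{Aut}^{-}V=\{f\in\mathrm{Aut}\,V\mid f(V_n)\subset\bigoplus_{k\le n}V_k\text{ and }\mathrm{pr}_n\circ f|_{V_n}=\mathrm{id}_{V_n}\text{ for all }n\}$; $J_1(V)=\{a\in V_1\mid a(0)=0\}$. *)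

theory Defs
  imports "HOL-Analysis.Linear_Algebra" "HOL-Library.Groups_Big_Fun" "HOL-Algebra.Coset"
begin

section \<open>Vertex algebras over the reals\<close>

text \<open>
  The underlying space is a real vector space type, and \<open>Y a n b\<close> is the \<open>n\<close>-th product
  \<open>a(n)b\<close>. The generating series \<open>Y(a,z)\<close> is represented by its modes \<open>Y a n\<close>. In the
  Borcherds identity the truncation axiom makes each \<^const>\<open>Sum_any\<close> a finite sum.
\<close>

locale vertex_algebra =
  fixes Y :: "'v::real_vector \<Rightarrow> int \<Rightarrow> 'v \<Rightarrow> 'v"
    and vac :: 'v
  assumes bilinear_Y: "\<And>n. bilinear (\<lambda>a b. Y a n b)"
    and truncation: "\<And>a b. \<exists>N. \<forall>n\<ge>N. Y a n b = 0"
    and vac_left: "\<And>n a. Y vac n a = (if n = -1 then a else 0)"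
    and vac_right: "\<And>a n. n \<ge> 0 \<Longrightarrow> Y a n vac = 0"
    and creation: "\<And>a. Y a (-1) vac = a"
    and borcherds: "\<And>a b c p q r.
      Sum_any (\<lambda>i::nat. (of_int p gchoose i) *\<^sub>R Y (Y a (r + int i) b) (p + q - int i) c) =
      Sum_any (\<lambda>i::nat. ((-1) ^ i * (of_int r gchoose i)) *\<^sub>R
        (Y a (p + r - int i) (Y b (q + int i) c)
         - ((-1) powi r) *\<^sub>R Y b (q + r - int i) (Y a (p + int i) c)))"

definition translation :: "('v::real_vector \<Rightarrow> int \<Rightarrow> 'v \<Rightarrow> 'v) \<Rightarrow> 'v \<Rightarrow> 'v \<Rightarrow> 'v" where
  "translation Y vac a = Y a (-2) vac"

definition va_ideal :: "('v::real_vector \<Rightarrow> int \<Rightarrow> 'v \<Rightarrow> 'v) \<Rightarrow> 'v set \<Rightarrow> bool" where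
  "va_ideal Y I \<longleftrightarrow> subspace I \<and> (\<forall>a n. \<forall>v\<in>I. Y a n v \<in> I \<and> Y v n a \<in> I)"

definition simple_va :: "('v::real_vector \<Rightarrow> int \<Rightarrow> 'v \<Rightarrow> 'v) \<Rightarrow> bool" where
  "simple_va Y \<longleftrightarrow> (\<forall>I. va_ideal Y I \<longrightarrow> I = {0} \<or> I = UNIV)"

section \<open>Gradings\<close>

definition is_decomposition ::
    "(int \<Rightarrow> 'v::real_vector set) \<Rightarrow> 'v \<Rightarrow> (int \<Rightarrow> 'v) \<Rightarrow> bool" where
  "is_decomposition V v f \<longleftrightarrow>
     (\<forall>n. f n \<in> V n) \<and> finite {n. f n \<noteq> 0} \<and> v = Sum_any f"

definition direct_sum :: "(int \<Rightarrow> 'v::real_vector set) \<Rightarrow> bool" where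
  "direct_sum V \<longleftrightarrow> (\<forall>n. subspace (V n)) \<and> (\<forall>v. \<exists>!f. is_decomposition V v f)"

definition proj :: "(int \<Rightarrow> 'v::real_vector set) \<Rightarrow> int \<Rightarrow> 'v \<Rightarrow> 'v" where
  "proj V n v = (THE f. is_decomposition V v f) n"

locale graded_vertex_algebra = vertex_algebra Y vac
  for Y :: "'v::real_vector \<Rightarrow> int \<Rightarrow> 'v \<Rightarrow> 'v" and vac :: 'v +
  fixes V :: "int \<Rightarrow> 'v set"
  assumes direct_sum: "direct_sum V"
    and graded_Y: "\<And>n m k a b. a \<in> V n \<Longrightarrow> b \<in> V m \<Longrightarrow> Y a k b \<in> V (n + m - k - 1)"
    and graded_vac: "vac \<in> V 0"

section \<open>Conformal vertex algebras and VOAs\<close>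

definition L_op ::
    "('v::real_vector \<Rightarrow> int \<Rightarrow> 'v \<Rightarrow> 'v) \<Rightarrow> 'v \<Rightarrow> int \<Rightarrow> 'v \<Rightarrow> 'v" where
  "L_op Y \<omega> n v = Y \<omega> (n + 1) v"

locale conformal_vertex_algebra = graded_vertex_algebra Y vac V
  for Y :: "'v::real_vector \<Rightarrow> int \<Rightarrow> 'v \<Rightarrow> 'v" and vac :: 'v and V :: "int \<Rightarrow> 'v set" +
  fixes \<omega> :: 'v
  assumes omega_degree: "\<omega> \<in> V 2"
    and virasoro: "\<exists>c::real. \<forall>n m v.
      L_op Y \<omega> n (L_op Y \<omega> m v) - L_op Y \<omega> m (L_op Y \<omega> n v) =
      of_int (n - m) *\<^sub>R L_op Y \<omega> (n + m) v
      + (if n + m = 0 then (1 / 12 * of_int (n ^ 3 - n) * c) *\<^sub>R v else 0)"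
    and L0_eigen: "\<And>n v. v \<in> V n \<Longrightarrow> L_op Y \<omega> 0 v = of_int n *\<^sub>R v"
    and L_minus1: "\<And>v. L_op Y \<omega> (-1) v = translation Y vac v"

locale voa_CFT_type = conformal_vertex_algebra Y vac V \<omega>
  for Y :: "'v::real_vector \<Rightarrow> int \<Rightarrow> 'v \<Rightarrow> 'v"
    and vac :: 'v and V :: "int \<Rightarrow> 'v set" and \<omega> :: 'v +
  assumes nonneg_graded: "\<And>n. n < 0 \<Longrightarrow> V n = {0}"
    and finite_dim: "\<And>n. \<exists>B. finite B \<and> V n = span B"
    and V0: "V 0 = span {vac}"

locale voa_strong_CFT_type = voa_CFT_type Y vac V \<omega>
  for Y :: "'v::real_vector \<Rightarrow> int \<Rightarrow> 'v \<Rightarrow> 'v"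
    and vac :: 'v and V :: "int \<Rightarrow> 'v set" and \<omega> :: 'v +
  assumes L1_V1: "\<And>v. v \<in> V 1 \<Longrightarrow> L_op Y \<omega> 1 v = 0"

section \<open>Invariant bilinear forms\<close>

text \<open>
  For \<open>a \<in> V k\<close> the series \<open>Y(e\<^bsup>zL(1)\<^esup>(-z\<^sup>-\<^sup>2)\<^bsup>L(0)\<^esup>a, z\<^sup>-\<^sup>1)v\<close> is the sum over \<open>i \<ge> 0\<close>
  and \<open>m\<close> of \<open>(-1)\<^sup>k / i! * (L(1)\<^sup>i a)(m)v * z\<^bsup>m + 1 + i - 2k\<^esup>\<close>. The coefficient of \<open>z\<^bsup>-n-1\<^esup>\<close>,
  which is compared with \<open>a(n)\<close>, comes from \<open>m = 2k - n - 2 - i\<close>. For a grading bounded below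
  the sum over \<open>i\<close> is finite. Both sides of the invariance condition are linear in \<open>a\<close>, so
  homogeneous \<open>a\<close> determine it.
\<close>

definition invariant_form ::
    "('v::real_vector \<Rightarrow> int \<Rightarrow> 'v \<Rightarrow> 'v) \<Rightarrow> (int \<Rightarrow> 'v set) \<Rightarrow> 'v \<Rightarrow> ('v \<Rightarrow> 'v \<Rightarrow> real) \<Rightarrow> bool" where
  "invariant_form Y V \<omega> B \<longleftrightarrow> bilinear B \<and>
     (\<forall>k. \<forall>a\<in>V k. \<forall>n u v.
        B (Y a n u) v =
        Sum_any (\<lambda>i::nat. (-1) powi k / fact i *
          B u (Y ((L_op Y \<omega> 1 ^^ i) a) (2 * k - n - 2 - int i) v)))"

definition positive_definite :: "('v::real_vector \<Rightarrow> 'v \<Rightarrow> real) \<Rightarrow> bool" where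
  "positive_definite B \<longleftrightarrow> (\<forall>v. v \<noteq> 0 \<longrightarrow> B v v > 0)"

section \<open>Conformal vectors and automorphisms\<close>

definition CV :: "('v::real_vector \<Rightarrow> int \<Rightarrow> 'v \<Rightarrow> 'v) \<Rightarrow> 'v \<Rightarrow> 'v set" where
  "CV Y vac = {a. conformal_vertex_algebra Y vac (\<lambda>n. {v. Y a 1 v = of_int n *\<^sub>R v}) a}"

definition J1 :: "('v::real_vector \<Rightarrow> int \<Rightarrow> 'v \<Rightarrow> 'v) \<Rightarrow> (int \<Rightarrow> 'v set) \<Rightarrow> 'v set" where
  "J1 Y V = {a \<in> V 1. \<forall>v. Y a 0 v = 0}"

definition Aut :: "('v::real_vector \<Rightarrow> int \<Rightarrow> 'v \<Rightarrow> 'v) \<Rightarrow> 'v \<Rightarrow> ('v \<Rightarrow> 'v) set" where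
  "Aut Y vac = {f. linear f \<and> bij f \<and> (\<forall>a b n. f (Y a n b) = Y (f a) n (f b)) \<and> f vac = vac}"

definition Aut_group ::
    "('v::real_vector \<Rightarrow> int \<Rightarrow> 'v \<Rightarrow> 'v) \<Rightarrow> 'v \<Rightarrow> ('v \<Rightarrow> 'v) monoid" where
  "Aut_group Y vac = \<lparr>carrier = Aut Y vac, mult = (\<circ>), one = id\<rparr>"

definition Aut_fix ::
    "('v::real_vector \<Rightarrow> int \<Rightarrow> 'v \<Rightarrow> 'v) \<Rightarrow> 'v \<Rightarrow> 'v \<Rightarrow> ('v \<Rightarrow> 'v) set" where
  "Aut_fix Y vac \<omega> = {f \<in> Aut Y vac. f \<omega> = \<omega>}"

definition Aut_minus ::
    "('v::real_vector \<Rightarrow> int \<Rightarrow> 'v \<Rightarrow> 'v) \<Rightarrow> 'v \<Rightarrow> (int \<Rightarrow> 'v set) \<Rightarrow> ('v \<Rightarrow> 'v) set" where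
  "Aut_minus Y vac V = {f \<in> Aut Y vac. \<forall>n.
     f ` V n \<subseteq> span (\<Union>k\<in>{..n}. V k) \<and> (\<forall>v\<in>V n. proj V n (f v) = v)}"

definition internal_semidirect_product ::
    "('g, 'm) monoid_scheme \<Rightarrow> 'g set \<Rightarrow> 'g set \<Rightarrow> bool" where
  "internal_semidirect_product G N H \<longleftrightarrow>
     N \<lhd> G \<and> subgroup H G \<and> N \<inter> H = {\<one>\<^bsub>G\<^esub>} \<and> N <#>\<^bsub>G\<^esub> H = carrier G"

end

theory Submission
  imports Defs
begin

text \<open>
  Write \<open>T = L(-1)\<close>. Let \<open>w\<close> be a conformal vector with homogeneous components \<open>w\<^sub>n \<in> V\<^sub>n\<close>. Since
  \<open>w(0) = T = \<omega>(0)\<close>, comparing degrees gives \<open>w\<^sub>n(0) = 0\<close> for \<open>n \<noteq> 2\<close> and \<open>w\<^sub>2(0) = T\<close>. So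
  \<open>a = w\<^sub>1\<close> lies in \<open>J\<^sub>1(V)\<close>. Skew symmetry with \<open>\<omega>\<close> and injectivity of \<open>T\<close> in positive degree show
  that a vector \<open>x\<close> of degree at least \<open>2\<close> with \<open>x(0) = 0\<close> is a translate
  (\<open>zero_mode_eq_0_imp_T_image\<close>). Hence \<open>w\<^sub>2 = \<omega> + T z\<^sub>2\<close> and \<open>w\<^sub>n = T z\<^sub>n\<close> for \<open>n \<ge> 3\<close>, and
  \<open>w(1) = L(0) + a(1) - \<Sum>\<^sub>n z\<^sub>n(0)\<close>.

  The main point is that all \<open>z\<^sub>n(0)\<close> vanish. The two-point form \<open>(u, v) \<mapsto> (\<one>, u(n)v)\<close>, with \<open>n\<close>
  such that \<open>u(n)v\<close> has degree \<open>0\<close>, is definite of sign \<open>(-1)\<^sup>H\<close> on \<open>V\<^sub>H\<close>. This follows by induction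
  on \<open>H\<close> from \<open>V\<^sub>H = ker L(1) \<oplus> T V\<^sub>H\<^sub>-\<^sub>1\<close>, as the form agrees with \<open>\<plusminus>(u, v)\<close> on \<open>ker L(1)\<close>
  (\<open>two_point_pos\<close>). The zero mode of a vector of positive degree is a derivation whose image is
  orthogonal to \<open>\<one>\<close>, so it is skew for the two-point form. Therefore \<open>z(0)\<^sup>2 u = 0\<close> implies
  \<open>z(0)u = 0\<close>, and a \<open>z(0)\<close> that preserves degrees has no nonzero real eigenvalue. On the other hand
  \<open>w(1)\<close> is diagonalizable with integer eigenvalues. Its highest nontrivial \<open>z\<^sub>N(0)\<close> would be locally
  nilpotent if \<open>N \<ge> 3\<close>, and diagonalizable with integer eigenvalues on each \<open>V\<^sub>m\<close> if \<open>N = 2\<close>, so it is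
  zero (\<open>CV_top_component\<close>, \<open>CV_mode_1\<close>). Thus \<open>w(1) = L(0) + a(1)\<close>, and the components of
  \<open>w(1)w = 2w\<close> give \<open>w\<^sub>n = 0\<close> for \<open>n \<ge> 3\<close> and \<open>w\<^sub>0 = a(1)a/2\<close>.

  Conversely, for \<open>a, b \<in> J\<^sub>1(V)\<close> the vector \<open>\<omega> + Tb\<close> is conformal for the same grading, and the locally
  nilpotent derivation \<open>a(1)\<close> exponentiates to an automorphism in \<open>Aut\<^sup>- V\<close> that carries it to
  \<open>a(1)a/2 + a + \<omega> + Tb\<close>.

  If \<open>f\<close> is an automorphism, then \<open>f \<omega>\<close> is conformal, hence equal to \<open>exp(a(1))(\<omega> + Tb)\<close>. The
  automorphism \<open>h = exp(a(1))\<^sup>-\<^sup>1 f\<close> preserves the grading, and comparing \<open>L(1)\<close> on \<open>V\<^sub>1\<close> before and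
  after conjugation by \<open>h\<close> forces \<open>b = 0\<close>. So \<open>f\<close> is the product of \<open>exp(a(1)) \<in> Aut\<^sup>- V\<close> and
  \<open>h \<in> Aut\<^sub>\<omega> V\<close> (\<open>Aut_factorization\<close>).
\<close>

section \<open>Products in a vertex algebra\<close>

context vertex_algebra
begin

abbreviation T :: "'v \<Rightarrow> 'v" where
  "T \<equiv> translation Y vac"

lemma linear_Y_right: "linear (\<lambda>b. Y a n b)"
  and linear_Y_left: "linear (\<lambda>a. Y a n b)"
  using bilinear_Y[of n] by (auto simp: bilinear_def)

lemma linear_Y: "linear (Y a n)"
  using linear_Y_right by simp

lemmas Y_linear_simps =
  linear_add[OF linear_Y_right] linear_add[OF linear_Y_left]
  linear_diff[OF linear_Y_right] linear_diff[OF linear_Y_left]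
  linear_scale[OF linear_Y_right] linear_scale[OF linear_Y_left]
  linear_neg[OF linear_Y_right] linear_neg[OF linear_Y_left]

lemma Y_zero [simp]: "Y a n 0 = 0" "Y 0 n b = 0"
  using linear_0[OF linear_Y_right] linear_0[OF linear_Y_left] by auto

lemma linear_T: "linear T"
  unfolding translation_def using linear_Y_left .

lemma T_vac: "T vac = 0"
  by (simp add: translation_def vac_left)

text \<open>The Borcherds identity with \<open>r = 0\<close>; the bound \<open>N\<close> makes the sum an ordinary finite one.\<close>

lemma commutator:
  assumes "\<And>i. i \<ge> N \<Longrightarrow> Y a (int i) b = 0"
  shows "Y a p (Y b q c) - Y b q (Y a p c) =
    (\<Sum>i<N. (of_int p gchoose i) *\<^sub>R Y (Y a (int i) b) (p + q - int i) c)"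
proof -
  have "Sum_any (\<lambda>i::nat. (of_int p gchoose i) *\<^sub>R Y (Y a (0 + int i) b) (p + q - int i) c) =
      Sum_any (\<lambda>i::nat. ((-1) ^ i * (of_int 0 gchoose i)) *\<^sub>R
        (Y a (p + 0 - int i) (Y b (q + int i) c)
         - ((-1) powi 0) *\<^sub>R Y b (q + 0 - int i) (Y a (p + int i) c)))"
    by (rule borcherds)
  also have "\<dots> = (\<Sum>i\<in>{0::nat}. ((-1) ^ i * (of_int 0 gchoose i)) *\<^sub>R
        (Y a (p + 0 - int i) (Y b (q + int i) c)
         - ((-1) powi 0) *\<^sub>R Y b (q + 0 - int i) (Y a (p + int i) c)))"
    by (rule Sum_any.expand_superset) (auto simp: gbinomial_0_left split: if_splits)
  also have "\<dots> = Y a p (Y b q c) - Y b q (Y a p c)"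
    by simp
  finally have "Y a p (Y b q c) - Y b q (Y a p c) =
      Sum_any (\<lambda>i::nat. (of_int p gchoose i) *\<^sub>R Y (Y a (int i) b) (p + q - int i) c)"
    by simp
  also have "\<dots> = (\<Sum>i<N. (of_int p gchoose i) *\<^sub>R Y (Y a (int i) b) (p + q - int i) c)"
    by (rule Sum_any.expand_superset) (auto, metis assms leI scaleR_zero_right Y_zero(2))
  finally show ?thesis .
qed

text \<open>The zero mode of every vector is a derivation of all products.\<close>

lemma zero_mode_derivation: "Y a 0 (Y b q c) = Y (Y a 0 b) q c + Y b q (Y a 0 c)"
proof -
  obtain N where N: "\<forall>n\<ge>N. Y a n b = 0"
    using truncation by blast
  have "Y a 0 (Y b q c) - Y b q (Y a 0 c) =
      (\<Sum>i<Suc (nat N). (of_int 0 gchoose i) *\<^sub>R Y (Y a (int i) b) (0 + q - int i) c)"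
    by (rule commutator) (use N in auto)
  also have "\<dots> = (\<Sum>i\<in>{0}. (of_int 0 gchoose i) *\<^sub>R Y (Y a (int i) b) (0 + q - int i) c)"
    by (rule sum.mono_neutral_right) (auto simp: gbinomial_0_left)
  finally show ?thesis
    by (simp add: algebra_simps)
qed

text \<open>The Borcherds identity with \<open>b = \<one>\<close>, \<open>p = 0\<close> and \<open>r = -2\<close>.\<close>

lemma Y_T_left: "Y (T a) n c = (- of_int n) *\<^sub>R Y a (n - 1) c"
proof -
  have "Y (T a) n c = (\<Sum>i\<in>{0::nat}. (of_int 0 gchoose i) *\<^sub>R Y (Y a (-2 + int i) vac) (0 + n - int i) c)"
    by (simp add: translation_def)
  also have "\<dots> = Sum_any (\<lambda>i::nat. (of_int 0 gchoose i) *\<^sub>R Y (Y a (-2 + int i) vac) (0 + n - int i) c)"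
    by (rule Sum_any.expand_superset[symmetric]) (auto simp: gbinomial_0_left split: if_splits)
  also have "\<dots> = Sum_any (\<lambda>i::nat. ((-1) ^ i * (of_int (-2) gchoose i)) *\<^sub>R
        (Y a (0 + -2 - int i) (Y vac (n + int i) c)
         - ((-1) powi (-2)) *\<^sub>R Y vac (n + -2 - int i) (Y a (0 + int i) c)))"
    by (rule borcherds)
  also have "\<dots> = Sum_any (\<lambda>i::nat. (of_nat i + 1) *\<^sub>R
        ((if n + int i = -1 then Y a (n - 1) c else 0) - (if int i = n - 1 then Y a (n - 1) c else 0)))"
    (is "Sum_any ?f = Sum_any ?g")
  proof (rule arg_cong[where f = Sum_any], rule ext)
    fix i :: nat
    have "(-1) ^ i * ((-2::real) gchoose i) = of_nat i + 1"
    proof -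
      have "(- (2::real)) gchoose i = (-1) ^ i * ((2 + of_nat i - 1) gchoose i)"
        by (rule gbinomial_minus)
      moreover have "(2 + of_nat i - 1 :: real) gchoose i = of_nat (Suc i choose i)"
        using binomial_gbinomial[of "Suc i" i, where ?'a = real] by (simp add: add.commute)
      ultimately show ?thesis
        by (simp flip: power_mult_distrib mult.assoc)
    qed
    moreover have "Y a (0 + -2 - int i) (Y vac (n + int i) c) = (if n + int i = -1 then Y a (n - 1) c else 0)"
    proof (cases "n + int i = -1")
      case True
      then have "0 + -2 - int i = n - 1" by linarith
      with True show ?thesis by (simp only: vac_left if_True refl)
    qed (simp add: vac_left)
    moreover have "Y vac (n + -2 - int i) (Y a (0 + int i) c) = (if int i = n - 1 then Y a (n - 1) c else 0)"
      by (auto simp: vac_left)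
    ultimately show "?f i = ?g i"
      by simp
  qed
  also have "\<dots> = (\<Sum>i\<in>{nat (- 1 - n), nat (n - 1)}. ?g i)"
    by (rule Sum_any.expand_superset) (auto split: if_splits)
  also have "\<dots> = (- of_int n) *\<^sub>R Y a (n - 1) c"
  proof -
    consider "n = 0" | "n > 0" | "n < 0" by linarith
    then show ?thesis
    proof cases
      case 2
      then show ?thesis
        by (cases "n = 1") (auto simp: algebra_simps)
    next
      case 3
      then show ?thesis
        by (cases "n = -1") (auto simp: algebra_simps)
    qed auto
  qed
  finally show ?thesis .
qed

text \<open>Skew symmetry \<open>a(n)b = (-1)\<^sup>n\<^sup>+\<^sup>1 b(n)a + \<dots>\<close> for \<open>n \<ge> 0\<close>. The terms with \<open>i < n\<close> vanish, the
  one with \<open>i = n\<close> is the leading term, and those with \<open>i > n\<close> are left as modes on the vacuum instead of powers of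
  \<open>T\<close>. It is the commutator of \<open>b(-1)\<close> and \<open>a(n)\<close> applied to \<open>\<one>\<close>.\<close>

lemma skew_symmetry:
  assumes "n \<ge> 0" and "\<And>i. i \<ge> N \<Longrightarrow> Y b (int i) a = 0"
  shows "Y a n b = - (\<Sum>i<N. ((-1) ^ i) *\<^sub>R Y (Y b (int i) a) (n - 1 - int i) vac)"
proof -
  have *: "((-1::real) gchoose i) = (-1) ^ i" for i
    using gbinomial_minus[of "1::real" i] binomial_gbinomial[of i i, where ?'a = real] by simp
  have "Y b (-1) (Y a n vac) - Y a n (Y b (-1) vac) =
      (\<Sum>i<N. (of_int (-1) gchoose i) *\<^sub>R Y (Y b (int i) a) (-1 + n - int i) vac)"
    by (rule commutator) (use assms in auto)
  then have "- Y a n b = (\<Sum>i<N. ((-1) ^ i) *\<^sub>R Y (Y b (int i) a) (n - 1 - int i) vac)"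
    using assms(1) by (simp add: vac_right creation * algebra_simps)
  then show ?thesis
    by (metis minus_minus)
qed

end

section \<open>Homogeneous components\<close>

context graded_vertex_algebra
begin

lemma Y_in:
  assumes "a \<in> V n" "b \<in> V m" "l = n + m - k - 1"
  shows "Y a k b \<in> V l"
  using graded_Y[OF assms(1,2)] assms(3) by simp

abbreviation pr :: "int \<Rightarrow> 'v \<Rightarrow> 'v" where
  "pr \<equiv> proj V"

lemma subspace_V: "subspace (V n)"
  using direct_sum by (auto simp: direct_sum_def)

lemma is_decomposition_pr: "is_decomposition V v (\<lambda>n. pr n v)"
proof -
  have "\<exists>!f. is_decomposition V v f"
    using direct_sum by (auto simp: direct_sum_def)
  from theI'[OF this] show ?thesis
    unfolding proj_def .
qed

lemma pr_in: "pr n v \<in> V n"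
  and finite_pr: "finite {n. pr n v \<noteq> 0}"
  using is_decomposition_pr by (auto simp: is_decomposition_def)

lemma sum_pr:
  assumes "finite S" "{n. pr n v \<noteq> 0} \<subseteq> S"
  shows "(\<Sum>n\<in>S. pr n v) = v"
  using is_decomposition_pr[of v] Sum_any.expand_superset[OF assms]
  by (simp add: is_decomposition_def)

lemma pr_sum:
  assumes "finite S" "\<And>n. n \<in> S \<Longrightarrow> f n \<in> V n"
  shows "pr n (\<Sum>n\<in>S. f n) = (if n \<in> S then f n else 0)"
proof -
  define g where "g n = (if n \<in> S then f n else 0)" for n
  have "Sum_any g = (\<Sum>n\<in>S. g n)"
    by (rule Sum_any.expand_superset) (auto simp: g_def assms)
  also have "\<dots> = (\<Sum>n\<in>S. f n)"
    by (simp add: g_def)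
  finally have "is_decomposition V (\<Sum>n\<in>S. f n) g"
    using assms subspace_0[OF subspace_V]
    by (auto simp: is_decomposition_def g_def intro: finite_subset[OF _ assms(1)])
  moreover have "\<exists>!g. is_decomposition V (\<Sum>n\<in>S. f n) g"
    using direct_sum by (auto simp: direct_sum_def)
  ultimately have "(\<lambda>n. pr n (\<Sum>n\<in>S. f n)) = g"
    using is_decomposition_pr by blast
  then show ?thesis
    by (metis g_def)
qed

lemma pr_homogeneous:
  assumes "v \<in> V m"
  shows "pr n v = (if n = m then v else 0)"
  using pr_sum[of "{m}" "\<lambda>_. v" n] assms by auto

lemma pr_eqI:
  assumes "\<And>n. pr n u = pr n v"
  shows "u = v"
proof -
  have "u = (\<Sum>n\<in>{n. pr n u \<noteq> 0}. pr n u)"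
    by (rule sum_pr[OF finite_pr order_refl, symmetric])
  also have "\<dots> = (\<Sum>n\<in>{n. pr n v \<noteq> 0}. pr n v)"
    by (simp only: assms)
  also have "\<dots> = v"
    by (rule sum_pr[OF finite_pr order_refl])
  finally show ?thesis .
qed

lemma in_V_I:
  assumes "\<And>n. n \<noteq> m \<Longrightarrow> pr n v = 0"
  shows "v \<in> V m"
proof -
  have "{n. pr n v \<noteq> 0} \<subseteq> {m}"
    using assms by auto
  from sum_pr[OF _ this] have "pr m v = v"
    by simp
  then show ?thesis
    using pr_in[of m v] by metis
qed

lemma linear_pr: "linear (pr n)"
proof (rule linearI)
  fix u v :: 'v
  let ?S = "{n. pr n u \<noteq> 0} \<union> {n. pr n v \<noteq> 0}"
  have S: "finite ?S" by (simp add: finite_pr)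
  have "u + v = (\<Sum>n\<in>?S. pr n u + pr n v)"
    using S by (simp add: sum.distrib sum_pr)
  also have "pr n \<dots> = pr n u + pr n v"
    using S by (subst pr_sum) (auto simp: pr_in subspace_add[OF subspace_V])
  finally show "pr n (u + v) = pr n u + pr n v" .
next
  fix c :: real and v :: 'v
  let ?S = "{n. pr n v \<noteq> 0}"
  have "c *\<^sub>R v = (\<Sum>n\<in>?S. c *\<^sub>R pr n v)"
    by (simp add: finite_pr sum_pr flip: scaleR_sum_right)
  also have "pr n \<dots> = c *\<^sub>R pr n v"
    by (subst pr_sum) (auto simp: pr_in finite_pr subspace_scale[OF subspace_V])
  finally show "pr n (c *\<^sub>R v) = c *\<^sub>R pr n v" .
qed

lemmas pr_linear_simps =
  linear_add[OF linear_pr] linear_diff[OF linear_pr] linear_scale[OF linear_pr]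
  linear_neg[OF linear_pr] linear_0[OF linear_pr]

lemma linear_eq_on_homogeneous:
  assumes "linear f" "linear g" "\<And>m v. v \<in> V m \<Longrightarrow> f v = g v"
  shows "f v = g v"
proof -
  have "f v = (\<Sum>n\<in>{n. pr n v \<noteq> 0}. f (pr n v))"
    by (subst linear_sum[OF assms(1), symmetric]) (simp add: sum_pr finite_pr)
  also have "\<dots> = (\<Sum>n\<in>{n. pr n v \<noteq> 0}. g (pr n v))"
    by (rule sum.cong) (use assms(3) pr_in in auto)
  also have "\<dots> = g v"
    by (subst linear_sum[OF assms(2), symmetric]) (simp add: sum_pr finite_pr)
  finally show ?thesis .
qed

lemma pr_linear_expand:
  assumes "linear f" "finite S" "{n. pr n v \<noteq> 0} \<subseteq> S"
  shows "pr i (f v) = (\<Sum>k\<in>S. pr i (f (pr k v)))"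
proof -
  have "linear (\<lambda>v. pr i (f v))"
    using linear_compose[OF assms(1) linear_pr] by (simp add: o_def)
  from linear_sum[OF this, of "\<lambda>k. pr k v" S] show ?thesis
    using sum_pr[OF assms(2,3)] by simp
qed

text \<open>A linear map that shifts the degree by \<open>d\<close> commutes with taking components.\<close>

lemma pr_shift:
  assumes "linear f" "\<And>m v. v \<in> V m \<Longrightarrow> f v \<in> V (m + d)"
  shows "pr n (f v) = f (pr (n - d) v)"
proof (rule linear_eq_on_homogeneous[where f = "\<lambda>v. pr n (f v)" and g = "\<lambda>v. f (pr (n - d) v)"])
  show "linear (\<lambda>v. pr n (f v))" "linear (\<lambda>v. f (pr (n - d) v))"
    using linear_compose[OF assms(1) linear_pr] linear_compose[OF linear_pr assms(1)]
    by (simp_all add: o_def)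
next
  fix m v assume "v \<in> V m"
  with assms(2) show "pr n (f v) = f (pr (n - d) v)"
    using linear_0[OF assms(1)] by (simp add: pr_homogeneous[of _ m] pr_homogeneous[of _ "m + d"])
qed

lemma pr_Y_left:
  assumes "v \<in> V m"
  shows "pr n (Y x k v) = Y (pr (n - m + k + 1) x) k v"
proof -
  have "pr n (Y x k v) = Y (pr (n - (m - k - 1)) x) k v"
  proof (rule pr_shift[where f = "\<lambda>x. Y x k v", OF linear_Y_left])
    fix j u assume "u \<in> V j"
    then show "Y u k v \<in> V (j + (m - k - 1))"
      by (rule Y_in[OF _ assms]) simp
  qed
  then show ?thesis
    by (simp add: algebra_simps)
qed

lemma T_in:
  assumes "v \<in> V m"
  shows "T v \<in> V (m + 1)"
  unfolding translation_def by (rule Y_in[OF assms graded_vac]) simp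

end

section \<open>Exponentials of locally nilpotent derivations\<close>

text \<open>The exponential \<open>\<Sum>\<^sub>k D\<^sup>k v / k!\<close> of an operator that is nilpotent on every single vector. By
  nilpotency the family has finite support, so \<^const>\<open>Sum_any\<close> is the intended sum.\<close>

definition expD :: "('v::real_vector \<Rightarrow> 'v) \<Rightarrow> 'v \<Rightarrow> 'v" where
  "expD D v = Sum_any (\<lambda>k::nat. (1 / fact k) *\<^sub>R (D ^^ k) v)"

locale locally_nilpotent =
  fixes D :: "'v::real_vector \<Rightarrow> 'v"
  assumes linear_D: "linear D"
    and nilpotent: "\<exists>N. (D ^^ N) v = 0"
begin

lemma linear_funpow: "linear (D ^^ n)"
proof (induction n)
  case 0
  then show ?case by (simp only: funpow.simps linear_id)
next
  case (Suc n)
  then show ?case by (simp only: funpow.simps linear_compose[OF Suc linear_D])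
qed

lemma funpow_zero_mono:
  assumes "(D ^^ N) v = 0" "N \<le> n"
  shows "(D ^^ n) v = 0"
proof -
  have "(D ^^ n) v = (D ^^ (n - N)) ((D ^^ N) v)"
    using assms(2) by (metis comp_apply funpow_add le_add_diff_inverse2)
  then show ?thesis
    using assms(1) linear_0[OF linear_funpow] by simp
qed

lemma expD_eq:
  assumes "(D ^^ N) v = 0"
  shows "expD D v = (\<Sum>k<N. (1 / fact k) *\<^sub>R (D ^^ k) v)"
  unfolding expD_def
  by (rule Sum_any.expand_superset) (auto, metis assms funpow_zero_mono leI)

lemma linear_expD: "linear (expD D)"
proof (rule linearI)
  fix u v :: 'v
  obtain M N where "(D ^^ M) u = 0" "(D ^^ N) v = 0"
    using nilpotent by meson
  then have *: "(D ^^ (M + N)) u = 0" "(D ^^ (M + N)) v = 0"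
    by (auto intro: funpow_zero_mono)
  then have "(D ^^ (M + N)) (u + v) = 0"
    by (simp add: linear_add[OF linear_funpow])
  from expD_eq[OF this] expD_eq[OF *(1)] expD_eq[OF *(2)]
  show "expD D (u + v) = expD D u + expD D v"
    by (simp add: linear_add[OF linear_funpow] scaleR_add_right sum.distrib)
next
  fix c :: real and v :: 'v
  obtain N where N: "(D ^^ N) v = 0"
    using nilpotent by meson
  then have "(D ^^ N) (c *\<^sub>R v) = 0"
    by (simp add: linear_scale[OF linear_funpow])
  from expD_eq[OF this] expD_eq[OF N] show "expD D (c *\<^sub>R v) = c *\<^sub>R expD D v"
    by (simp add: linear_scale[OF linear_funpow] scaleR_sum_right mult.commute)
qed

lemma funpow_expD_diff:
  assumes "(D ^^ Suc N) v = 0"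
  shows "(D ^^ N) (expD D v) = (D ^^ N) v"
proof -
  have "(D ^^ N) (expD D v) = (\<Sum>k<Suc N. (1 / fact k) *\<^sub>R (D ^^ (N + k)) v)"
    unfolding expD_eq[OF assms] linear_sum[OF linear_funpow]
    by (simp add: linear_scale[OF linear_funpow] funpow_add)
  also have "\<dots> = (\<Sum>k\<in>{0}. (1 / fact k) *\<^sub>R (D ^^ (N + k)) v)"
    by (rule sum.mono_neutral_right) (auto intro: funpow_zero_mono[OF assms])
  finally show ?thesis by simp
qed

text \<open>The difference \<open>exp D v - v\<close> is killed by a smaller power of \<open>D\<close> than \<open>v\<close>, so kernel and preimages
  can be treated by induction on that power.\<close>

lemma bij_expD: "bij (expD D)"
proof (rule bijI)
  have "v = 0" if "expD D v = 0" "(D ^^ N) v = 0" for N v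
    using that
  proof (induction N)
    case (Suc N)
    then show ?case
      using funpow_expD_diff[OF Suc.prems(2)] linear_0[OF linear_funpow] by simp
  qed simp
  then show "inj (expD D)"
    using nilpotent by (meson linear_expD linear_injective_0)
  have "\<exists>w. expD D w = v" if "(D ^^ N) v = 0" for N v
    using that
  proof (induction N arbitrary: v)
    case 0
    then show ?case
      using linear_0[OF linear_expD] by auto
  next
    case (Suc N)
    have "(D ^^ N) (expD D v - v) = 0"
      using funpow_expD_diff[OF Suc.prems] by (simp add: linear_diff[OF linear_funpow])
    then obtain w where "expD D w = expD D v - v"
      using Suc.IH by blast
    then have "expD D (v - w) = v"
      by (simp add: linear_diff[OF linear_expD])
    then show ?case by blast
  qed
  then show "surj (expD D)"
    using nilpotent unfolding surj_def by metis
qed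

text \<open>Leibniz rule and its exponentiated form.\<close>

lemma funpow_bilinear:
  assumes "bilinear m" "\<And>u v. D (m u v) = m (D u) v + m u (D v)"
  shows "(D ^^ n) (m u v) = (\<Sum>i\<le>n. of_nat (n choose i) *\<^sub>R m ((D ^^ i) u) ((D ^^ (n - i)) v))"
proof (induction n)
  case (Suc n)
  let ?t = "\<lambda>i. m ((D ^^ i) u) ((D ^^ (Suc n - i)) v)"
  have "(D ^^ Suc n) (m u v) = (\<Sum>i\<le>n. of_nat (n choose i) *\<^sub>R D (m ((D ^^ i) u) ((D ^^ (n - i)) v)))"
    using Suc by (simp add: linear_sum[OF linear_D] linear_scale[OF linear_D])
  also have "\<dots> = (\<Sum>i\<le>n. of_nat (n choose i) *\<^sub>R ?t (Suc i)) + (\<Sum>i\<le>n. of_nat (n choose i) *\<^sub>R ?t i)"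
    by (simp add: assms(2) scaleR_add_right sum.distrib Suc_diff_le)
  also have "(\<Sum>i\<le>n. of_nat (n choose i) *\<^sub>R ?t i) = (\<Sum>i\<le>Suc n. of_nat (n choose i) *\<^sub>R ?t i)"
    by simp
  also have "\<dots> = ?t 0 + (\<Sum>i\<le>n. of_nat (n choose Suc i) *\<^sub>R ?t (Suc i))"
    by (subst sum.atMost_Suc_shift) simp
  also have "(\<Sum>i\<le>n. of_nat (n choose i) *\<^sub>R ?t (Suc i)) + \<dots> =
      ?t 0 + (\<Sum>i\<le>n. of_nat (Suc n choose Suc i) *\<^sub>R ?t (Suc i))"
    by (simp add: scaleR_add_left sum.distrib)
  also have "\<dots> = (\<Sum>i\<le>Suc n. of_nat (Suc n choose i) *\<^sub>R ?t i)"
    by (subst sum.atMost_Suc_shift) simp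
  finally show ?case .
qed simp

lemma expD_bilinear:
  assumes m: "bilinear m" "\<And>u v. D (m u v) = m (D u) v + m u (D v)"
  shows "expD D (m u v) = m (expD D u) (expD D v)"
proof -
  obtain M N where MN: "(D ^^ M) u = 0" "(D ^^ N) v = 0"
    using nilpotent by meson
  let ?f = "\<lambda>i j. (1 / fact i) *\<^sub>R (1 / fact j) *\<^sub>R m ((D ^^ i) u) ((D ^^ j) v)"
  have z: "m ((D ^^ i) u) ((D ^^ j) v) = 0" if "i \<ge> M \<or> j \<ge> N" for i j
    using that MN funpow_zero_mono bilinear_lzero[OF m(1)] bilinear_rzero[OF m(1)] by auto
  have k: "(1 / fact k) *\<^sub>R (D ^^ k) (m u v) = (\<Sum>i\<le>k. ?f i (k - i))" for k
    unfolding funpow_bilinear[OF m] scaleR_sum_right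
    by (rule sum.cong) (auto simp: binomial_fact)
  have "(D ^^ (M + N)) (m u v) = 0"
  proof -
    have "(\<Sum>i\<le>M + N. ?f i (M + N - i)) = 0"
    proof (rule sum.neutral, rule ballI)
      fix i assume "i \<in> {..M + N}"
      have "i \<ge> M \<or> M + N - i \<ge> N" by linarith
      then show "?f i (M + N - i) = 0" by (simp add: z)
    qed
    with k[of "M + N"] show ?thesis by simp
  qed
  then have "expD D (m u v) = (\<Sum>k<M + N. \<Sum>i\<le>k. ?f i (k - i))"
    by (simp add: expD_eq k)
  also have "\<dots> = (\<Sum>(i, j)\<in>{(i, j). i + j < M + N}. ?f i j)"
    by (rule sum.triangle_reindex[symmetric])
  also have "\<dots> = (\<Sum>(i, j)\<in>{..<M} \<times> {..<N}. ?f i j)"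
  proof (rule sum.mono_neutral_right)
    show "finite {(i, j). i + j < M + N}"
      by (rule finite_subset[of _ "{..<M + N} \<times> {..<M + N}"]) auto
  qed (auto, (metis z leI)+)
  also have "\<dots> = m (expD D u) (expD D v)"
    unfolding expD_eq[OF MN(1)] expD_eq[OF MN(2)] bilinear_sum[OF m(1)]
    by (simp add: bilinear_lmul[OF m(1)] bilinear_rmul[OF m(1)] mult.commute)
  finally show ?thesis .
qed

end

section \<open>Automorphisms and conformal vectors\<close>

lemma is_decomposition_image:
  assumes f: "linear f" "bij f"
  shows "is_decomposition (\<lambda>n. f ` V n) (f u) (\<lambda>n. f (g n)) \<longleftrightarrow> is_decomposition V u g"
proof -
  have inj: "f x = f y \<longleftrightarrow> x = y" for x y
    using f(2) by (meson bij_is_inj inj_eq)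
  have supp: "{n. f (g n) \<noteq> 0} = {n. g n \<noteq> 0}"
    using inj[of _ 0] linear_0[OF f(1)] by simp
  have "Sum_any (\<lambda>n. f (g n)) = f (Sum_any g)" if "finite {n. g n \<noteq> 0}"
    using that by (simp add: Sum_any.expand_set supp linear_sum[OF f(1)])
  moreover have "f x \<in> f ` A \<longleftrightarrow> x \<in> A" for x A
    using inj by auto
  ultimately show ?thesis
    unfolding is_decomposition_def supp using inj by auto
qed

lemma direct_sum_image:
  assumes f: "linear f" "bij f" and V: "direct_sum V"
  shows "direct_sum (\<lambda>n. f ` V n)"
  unfolding direct_sum_def
proof (intro conjI allI)
  fix n
  show "subspace (f ` V n)"
    using V linear_subspace_image[OF f(1)] by (auto simp: direct_sum_def)
next
  fix v
  obtain u where u: "v = f u"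
    using f(2) by (meson bij_pointE)
  obtain g where g: "is_decomposition V u g" "\<And>h. is_decomposition V u h \<Longrightarrow> h = g"
    using V unfolding direct_sum_def by metis
  show "\<exists>!h. is_decomposition (\<lambda>n. f ` V n) v h"
  proof (rule ex1I)
    show "is_decomposition (\<lambda>n. f ` V n) v (\<lambda>n. f (g n))"
      using g(1) is_decomposition_image[OF f] u by blast
  next
    fix h assume h: "is_decomposition (\<lambda>n. f ` V n) v h"
    have "h = (\<lambda>n. f (inv_into UNIV f (h n)))"
      using f(2) by (simp add: bij_is_surj surj_f_inv_f)
    moreover from this h u have "is_decomposition V u (\<lambda>n. inv_into UNIV f (h n))"
      using is_decomposition_image[OF f, of V u "\<lambda>n. inv_into UNIV f (h n)"] by simp
    ultimately show "h = (\<lambda>n. f (g n))"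
      using g(2) by metis
  qed
qed

context vertex_algebra
begin

lemma Aut_D:
  assumes "f \<in> Aut Y vac"
  shows "linear f" "bij f" "f (Y a n b) = Y (f a) n (f b)" "f vac = vac"
  using assms by (auto simp: Aut_def)

lemma Aut_T:
  assumes "f \<in> Aut Y vac"
  shows "f (T v) = T (f v)"
  by (simp add: translation_def Aut_D[OF assms])

lemma Aut_comp:
  assumes "f \<in> Aut Y vac" "g \<in> Aut Y vac"
  shows "f \<circ> g \<in> Aut Y vac"
  using assms by (auto simp: Aut_def linear_compose bij_comp)

lemma Aut_id: "id \<in> Aut Y vac"
  by (simp add: Aut_def linear_id)

lemma Aut_inv:
  assumes "f \<in> Aut Y vac"
  shows "inv_into UNIV f \<in> Aut Y vac"
proof -
  note f = Aut_D[OF assms]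
  have *: "f (inv_into UNIV f x) = x" "inv_into UNIV f (f x) = x" for x
    using f(2) by (simp_all add: bij_is_surj surj_f_inv_f bij_is_inj)
  have inj: "x = y" if "f x = f y" for x y
    using that f(2) by (meson bij_is_inj inj_eq)
  have "linear (inv_into UNIV f)"
    by (rule linearI; rule inj) (simp_all add: * linear_add[OF f(1)] linear_scale[OF f(1)])
  moreover have "inv_into UNIV f (Y a n b) = Y (inv_into UNIV f a) n (inv_into UNIV f b)" for a n b
    by (rule inj) (simp add: * f(3))
  moreover have "inv_into UNIV f vac = vac"
    by (rule inj) (simp add: * f(4))
  ultimately show ?thesis
    using f(2) by (simp add: Aut_def bij_imp_bij_inv)
qed

end

context conformal_vertex_algebra
begin

lemma omega_0: "Y \<omega> 0 v = T v"
  using L_minus1[of v] by (simp add: L_op_def)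

lemma omega_1: "v \<in> V n \<Longrightarrow> Y \<omega> 1 v = of_int n *\<^sub>R v"
  using L0_eigen[of v n] by (simp add: L_op_def)

lemma pr_omega_1: "pr n (Y \<omega> 1 v) = of_int n *\<^sub>R pr n v"
proof -
  have "pr n (Y \<omega> 1 v) = Y \<omega> 1 (pr (n - 0) v)"
    by (rule pr_shift[OF linear_Y]) (auto simp: omega_1 subspace_scale[OF subspace_V])
  then show ?thesis
    using omega_1[OF pr_in] by simp
qed

lemma in_V_iff: "v \<in> V n \<longleftrightarrow> Y \<omega> 1 v = of_int n *\<^sub>R v"
proof
  assume *: "Y \<omega> 1 v = of_int n *\<^sub>R v"
  show "v \<in> V n"
  proof (rule in_V_I)
    fix m assume "m \<noteq> n"
    have "of_int m *\<^sub>R pr m v = of_int n *\<^sub>R pr m v"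
      using arg_cong[OF *, of "pr m"] by (simp add: pr_omega_1 pr_linear_simps)
    with \<open>m \<noteq> n\<close> show "pr m v = 0"
      by simp
  qed
qed (rule omega_1)

text \<open>An automorphism carries the conformal structure \<open>(V, \<omega>)\<close> to \<open>(f V, f \<omega>)\<close>, and \<open>f V\<^sub>n\<close> is the
  eigenspace of \<open>(f \<omega>)(1)\<close> for \<open>n\<close>.\<close>

lemma Aut_omega_in_CV:
  assumes "f \<in> Aut Y vac"
  shows "f \<omega> \<in> CV Y vac"
proof -
  note f = Aut_D[OF assms]
  let ?W = "\<lambda>n. f ` V n"
  have surj: "\<exists>u. v = f u" for v
    using f(2) by (meson bij_pointE)
  have inj: "f x = f y \<longleftrightarrow> x = y" for x y
    using f(2) by (meson bij_is_inj inj_eq)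
  have W: "(\<lambda>n. {v. Y (f \<omega>) 1 v = of_int n *\<^sub>R v}) = ?W"
  proof (rule HOL.ext, rule Set.set_eqI)
    fix n v
    obtain u where u: "v = f u" using surj by blast
    have "Y (f \<omega>) 1 v = of_int n *\<^sub>R v \<longleftrightarrow> f (Y \<omega> 1 u) = f (of_int n *\<^sub>R u)"
      by (simp add: u f(3) linear_scale[OF f(1)])
    also have "\<dots> \<longleftrightarrow> v \<in> ?W n"
      using inj u by (auto simp: in_V_iff)
    finally show "v \<in> {v. Y (f \<omega>) 1 v = of_int n *\<^sub>R v} \<longleftrightarrow> v \<in> ?W n" by simp
  qed
  have L: "L_op Y (f \<omega>) n (f u) = f (L_op Y \<omega> n u)" for n u
    by (simp add: L_op_def f(3))
  have "conformal_vertex_algebra Y vac ?W (f \<omega>)"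
  proof unfold_locales
    show "direct_sum ?W"
      by (rule direct_sum_image[OF f(1,2) direct_sum])
    show "Y a k b \<in> ?W (n + m - k - 1)" if "a \<in> ?W n" "b \<in> ?W m" for n m k a b
      using that graded_Y by (auto simp flip: f(3))
    show "vac \<in> ?W 0"
      using graded_vac f(4) by (metis image_eqI)
    show "f \<omega> \<in> ?W 2"
      using omega_degree by simp
    obtain c :: real where c: "\<And>n m v.
      L_op Y \<omega> n (L_op Y \<omega> m v) - L_op Y \<omega> m (L_op Y \<omega> n v) =
      of_int (n - m) *\<^sub>R L_op Y \<omega> (n + m) v
      + (if n + m = 0 then (1 / 12 * of_int (n ^ 3 - n) * c) *\<^sub>R v else 0)"
      using virasoro by blast
    show "\<exists>c::real. \<forall>n m v.
      L_op Y (f \<omega>) n (L_op Y (f \<omega>) m v) - L_op Y (f \<omega>) m (L_op Y (f \<omega>) n v) =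
      of_int (n - m) *\<^sub>R L_op Y (f \<omega>) (n + m) v
      + (if n + m = 0 then (1 / 12 * of_int (n ^ 3 - n) * c) *\<^sub>R v else 0)"
    proof (intro exI allI)
      fix n m v
      obtain u where u: "v = f u" using surj by blast
      show "L_op Y (f \<omega>) n (L_op Y (f \<omega>) m v) - L_op Y (f \<omega>) m (L_op Y (f \<omega>) n v) =
        of_int (n - m) *\<^sub>R L_op Y (f \<omega>) (n + m) v
        + (if n + m = 0 then (1 / 12 * of_int (n ^ 3 - n) * c) *\<^sub>R v else 0)"
        using arg_cong[OF c[of n m u], of f] linear_0[OF f(1)] unfolding u L
        by (simp add: linear_diff[OF f(1)] linear_add[OF f(1)] linear_scale[OF f(1)] split: if_splits)
    qed
    show "L_op Y (f \<omega>) 0 v = of_int n *\<^sub>R v" if "v \<in> ?W n" for n v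
      using that by (auto simp: L L0_eigen linear_scale[OF f(1)])
    show "L_op Y (f \<omega>) (-1) v = T v" for v
    proof -
      obtain u where u: "v = f u" using surj by blast
      show ?thesis
        by (simp add: u L L_minus1 Aut_T[OF assms])
    qed
  qed
  then show ?thesis
    by (simp add: CV_def W)
qed

end

section \<open>Conformal vectors coming from \<open>J\<^sub>1\<close>\<close>

context conformal_vertex_algebra
begin

lemma L1_T:
  assumes "v \<in> V n"
  shows "Y \<omega> 2 (T v) = (2 * of_int n) *\<^sub>R v + T (Y \<omega> 2 v)"
proof -
  obtain c :: real where c: "\<And>n m v.
      L_op Y \<omega> n (L_op Y \<omega> m v) - L_op Y \<omega> m (L_op Y \<omega> n v) =
      of_int (n - m) *\<^sub>R L_op Y \<omega> (n + m) v
      + (if n + m = 0 then (1 / 12 * of_int (n ^ 3 - n) * c) *\<^sub>R v else 0)"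
    using virasoro by blast
  from c[of 1 "-1" v] show ?thesis
    by (simp add: L_op_def omega_0 omega_1[OF assms] algebra_simps)
qed

lemma L1_omega: "Y \<omega> 2 \<omega> = 0"
proof -
  obtain c :: real where c: "\<And>n m v.
      L_op Y \<omega> n (L_op Y \<omega> m v) - L_op Y \<omega> m (L_op Y \<omega> n v) =
      of_int (n - m) *\<^sub>R L_op Y \<omega> (n + m) v
      + (if n + m = 0 then (1 / 12 * of_int (n ^ 3 - n) * c) *\<^sub>R v else 0)"
    using virasoro by blast
  from c[of 1 "-2" vac] show ?thesis
    by (simp add: L_op_def vac_right creation)
qed

end

context voa_strong_CFT_type
begin

lemma V_neg: "v \<in> V n \<Longrightarrow> n < 0 \<Longrightarrow> v = 0"
  using nonneg_graded by auto

lemma V_zeroE: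
  assumes "v \<in> V 0"
  obtains c where "v = c *\<^sub>R vac"
  using assms V0 by (auto simp: span_singleton)

lemma Y_eq_0:
  assumes "a \<in> V n" "b \<in> V m" "n + m - k - 1 < 0"
  shows "Y a k b = 0"
  using V_neg[OF graded_Y[OF assms(1,2)] assms(3)] .

lemma omega_2_V1: "v \<in> V 1 \<Longrightarrow> Y \<omega> 2 v = 0"
  using L1_V1[of v] by (simp add: L_op_def)

lemma J1_D:
  assumes "a \<in> J1 Y V"
  shows "a \<in> V 1" "Y a 0 v = 0"
  using assms by (auto simp: J1_def)

lemma J1_mode_1_derivation:
  assumes "a \<in> J1 Y V"
  shows "Y a 1 (Y u k v) = Y (Y a 1 u) k v + Y u k (Y a 1 v)"
proof -
  obtain N where N: "\<forall>n\<ge>N. Y a n u = 0"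
    using truncation by blast
  have *: "(1::real) gchoose i = of_nat (1 choose i)" for i
    by (simp add: binomial_gbinomial)
  have "Y a 1 (Y u k v) - Y u k (Y a 1 v) =
      (\<Sum>i<nat N + 2. (of_int 1 gchoose i) *\<^sub>R Y (Y a (int i) u) (1 + k - int i) v)"
    by (rule commutator) (use N in auto)
  also have "\<dots> = (\<Sum>i\<in>{0, 1}. (of_int 1 gchoose i) *\<^sub>R Y (Y a (int i) u) (1 + k - int i) v)"
    by (rule sum.mono_neutral_right) (auto simp: * binomial_eq_0)
  also have "\<dots> = Y (Y a 1 u) k v"
    using J1_D[OF assms] by simp
  finally show ?thesis
    by (simp add: algebra_simps)
qed

lemma J1_mode_1_power_in:
  assumes "a \<in> J1 Y V" "v \<in> V n"
  shows "(Y a 1 ^^ k) v \<in> V (n - int k)"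
proof (induction k)
  case (Suc k)
  have "Y a 1 ((Y a 1 ^^ k) v) \<in> V (n - int (Suc k))"
    by (rule Y_in[OF J1_D(1)[OF assms(1)] Suc]) simp
  then show ?case by simp
qed (use assms(2) in simp)

lemma locally_nilpotent_J1:
  assumes a: "a \<in> J1 Y V"
  shows "locally_nilpotent (Y a 1)"
proof (rule locally_nilpotent.intro)
  show "linear (Y a 1)" by (rule linear_Y)
next
  fix v
  have lin: "linear (Y a 1 ^^ N)" for N
  proof (induction N)
    case 0
    then show ?case by (simp only: funpow.simps linear_id)
  next
    case (Suc N)
    then show ?case by (simp only: funpow.simps linear_compose[OF Suc linear_Y])
  qed
  obtain N where N: "\<And>n. pr n v \<noteq> 0 \<Longrightarrow> n < int N"
  proof -
    have "finite (insert 0 {n. pr n v \<noteq> 0})" by (simp add: finite_pr)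
    then have "n \<le> Max (insert 0 {n. pr n v \<noteq> 0})" if "pr n v \<noteq> 0" for n
      using that by simp
    then show ?thesis
      using that[of "nat (Max (insert 0 {n. pr n v \<noteq> 0}) + 1)"] by force
  qed
  have z: "pr n ((Y a 1 ^^ N) v) = 0" for n
  proof (cases "n < 0")
    case True
    then show ?thesis using V_neg[OF pr_in] by simp
  next
    case False
    have "pr n ((Y a 1 ^^ N) v) = (Y a 1 ^^ N) (pr (n - - int N) v)"
      by (rule pr_shift[OF lin]) (use J1_mode_1_power_in[OF a] in simp)
    also have "pr (n - - int N) v = 0"
      using N[of "n - - int N"] False by auto
    finally show ?thesis
      using linear_0[OF lin] by simp
  qed
  have "(Y a 1 ^^ N) v = 0"
    by (rule pr_eqI) (simp add: z pr_linear_simps)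
  then show "\<exists>N. (Y a 1 ^^ N) v = 0" ..
qed

lemma expD_J1_Aut:
  assumes a: "a \<in> J1 Y V"
  shows "expD (Y a 1) \<in> Aut Y vac"
proof -
  interpret D: locally_nilpotent "Y a 1"
    by (rule locally_nilpotent_J1[OF a])
  have "expD (Y a 1) vac = vac"
    using D.expD_eq[of 1 vac] by (simp add: vac_right)
  then show ?thesis
    using D.linear_expD D.bij_expD D.expD_bilinear[OF bilinear_Y J1_mode_1_derivation[OF a]]
    by (simp add: Aut_def)
qed

text \<open>The automorphism \<open>exp a(1)\<close> is unipotent for the degree filtration.\<close>

lemma pr_expD_J1:
  assumes a: "a \<in> J1 Y V" and v: "v \<in> V n" and "i \<ge> n"
  shows "pr i (expD (Y a 1) v - v) = 0"
proof -
  interpret D: locally_nilpotent "Y a 1"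
    by (rule locally_nilpotent_J1[OF a])
  obtain N where "(Y a 1 ^^ N) v = 0"
    using D.nilpotent by blast
  then have "(Y a 1 ^^ Suc N) v = 0"
    using D.funpow_zero_mono le_SucI by blast
  then have "expD (Y a 1) v = (\<Sum>k<Suc N. (1 / fact k) *\<^sub>R (Y a 1 ^^ k) v)"
    by (rule D.expD_eq)
  also have "\<dots> = v + (\<Sum>k<N. (1 / fact (Suc k)) *\<^sub>R (Y a 1 ^^ Suc k) v)"
    by (subst sum.lessThan_Suc_shift) simp
  finally have "pr i (expD (Y a 1) v - v) = (\<Sum>k<N. (1 / fact (Suc k)) *\<^sub>R pr i ((Y a 1 ^^ Suc k) v))"
    by (simp add: linear_sum[OF linear_pr] pr_linear_simps del: fact_Suc funpow.simps)
  also have "\<dots> = 0"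
  proof (rule sum.neutral, rule ballI)
    fix k
    have "pr i ((Y a 1 ^^ Suc k) v) = 0"
      using pr_homogeneous[OF J1_mode_1_power_in[OF a v, of "Suc k"], of i] \<open>i \<ge> n\<close> by auto
    then show "(1 / fact (Suc k)) *\<^sub>R pr i ((Y a 1 ^^ Suc k) v) = 0" by simp
  qed
  finally show ?thesis .
qed

lemma J1_mode_1_omega:
  assumes a: "a \<in> J1 Y V"
  shows "Y a 1 \<omega> = a"
proof -
  have "Y a 1 \<omega> = - (\<Sum>i<3. ((-1) ^ i) *\<^sub>R Y (Y \<omega> (int i) a) (1 - 1 - int i) vac)"
    by (rule skew_symmetry) (use Y_eq_0[OF omega_degree J1_D(1)[OF a]] in auto)
  also have "\<dots> = a"
    using J1_D(1)[OF a] by (simp add: numeral_3_eq_3 vac_right creation omega_1 omega_2_V1)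
  finally show ?thesis .
qed

lemma expD_J1_omega:
  assumes a: "a \<in> J1 Y V"
  shows "expD (Y a 1) \<omega> = \<omega> + a + (1 / 2) *\<^sub>R Y a 1 a"
proof -
  interpret D: locally_nilpotent "Y a 1"
    by (rule locally_nilpotent_J1[OF a])
  have "Y a 1 a \<in> V 0"
    by (rule Y_in[OF J1_D(1)[OF a] J1_D(1)[OF a]]) simp
  then have "Y a 1 (Y a 1 a) = 0"
    by (elim V_zeroE) (simp add: Y_linear_simps vac_right)
  then have "(Y a 1 ^^ 3) \<omega> = 0"
    by (simp add: numeral_3_eq_3 J1_mode_1_omega[OF a])
  from D.expD_eq[OF this] show ?thesis
    by (simp add: numeral_3_eq_3 J1_mode_1_omega[OF a])
qed

lemma expD_J1_T:
  assumes a: "a \<in> J1 Y V" and b: "b \<in> V 1"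
  shows "expD (Y a 1) (T b) = T b"
proof -
  interpret D: locally_nilpotent "Y a 1"
    by (rule locally_nilpotent_J1[OF a])
  have "Y a 1 b \<in> V 0"
    by (rule Y_in[OF J1_D(1)[OF a] b]) simp
  then obtain c where c: "Y a 1 b = c *\<^sub>R vac"
    by (rule V_zeroE)
  then have "(Y a 1 ^^ 2) b = 0"
    by (simp add: numeral_2_eq_2 Y_linear_simps vac_right)
  from D.expD_eq[OF this] have "expD (Y a 1) b = b + c *\<^sub>R vac"
    by (simp add: numeral_2_eq_2 c)
  then show ?thesis
    by (simp add: Aut_T[OF expD_J1_Aut[OF a]] linear_add[OF linear_T] linear_scale[OF linear_T] T_vac)
qed

lemma L_op_J1_bracket:
  assumes b: "b \<in> V 1"
  shows "L_op Y \<omega> n (Y b m v) = Y b m (L_op Y \<omega> n v) - of_int m *\<^sub>R Y b (n + m) v"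
proof -
  have "Y \<omega> (n + 1) (Y b m v) - Y b m (Y \<omega> (n + 1) v) =
      (\<Sum>i<3. (of_int (n + 1) gchoose i) *\<^sub>R Y (Y \<omega> (int i) b) (n + 1 + m - int i) v)"
    by (rule commutator) (use Y_eq_0[OF omega_degree b] in auto)
  also have "\<dots> = - of_int m *\<^sub>R Y b (n + m) v"
    using b by (simp add: numeral_3_eq_3 omega_0 Y_T_left omega_1 omega_2_V1 algebra_simps)
  finally show ?thesis
    by (simp add: L_op_def algebra_simps)
qed

lemma J1_J1_bracket:
  assumes b: "b \<in> J1 Y V" and \<beta>: "Y b 1 b = \<beta> *\<^sub>R vac"
  shows "Y b n (Y b m v) = Y b m (Y b n v) + (if n + m = 0 then (of_int n * \<beta>) *\<^sub>R v else 0)"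
proof -
  have "Y b n (Y b m v) - Y b m (Y b n v) =
      (\<Sum>i<2. (of_int n gchoose i) *\<^sub>R Y (Y b (int i) b) (n + m - int i) v)"
    by (rule commutator) (use Y_eq_0[OF J1_D(1)[OF b] J1_D(1)[OF b]] in auto)
  also have "\<dots> = (if n + m = 0 then (of_int n * \<beta>) *\<^sub>R v else 0)"
    by (simp add: numeral_2_eq_2 J1_D(2)[OF b] \<beta> Y_linear_simps vac_left)
  finally show ?thesis
    by (simp add: algebra_simps)
qed

lemma Y_omega_plus_T: "Y (\<omega> + T b) n v = Y \<omega> n v - of_int n *\<^sub>R Y b (n - 1) v"
  by (simp add: Y_linear_simps Y_T_left)

text \<open>Adding \<open>Tb\<close> with \<open>b \<in> J\<^sub>1\<close> changes \<open>L(n)\<close> to \<open>L(n) - (n+1) b(n)\<close>. The grading stays the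
  same, and the central charge \<open>c\<close> becomes \<open>c - 12 \<beta>\<close> where \<open>b(1)b = \<beta> \<one>\<close>.\<close>

lemma conformal_omega_plus_T:
  assumes b: "b \<in> J1 Y V"
  shows "conformal_vertex_algebra Y vac V (\<omega> + T b)"
proof unfold_locales
  show "\<omega> + T b \<in> V 2"
    using T_in[OF J1_D(1)[OF b]] omega_degree subspace_add[OF subspace_V] by simp
  have L: "L_op Y (\<omega> + T b) n v = L_op Y \<omega> n v - of_int (n + 1) *\<^sub>R Y b n v" for n v
    by (simp add: L_op_def Y_omega_plus_T)
  show "L_op Y (\<omega> + T b) 0 v = of_int n *\<^sub>R v" if "v \<in> V n" for n v
    using that by (simp add: L L0_eigen J1_D(2)[OF b])
  show "L_op Y (\<omega> + T b) (-1) v = T v" for v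
    by (simp add: L L_minus1)
  obtain c :: real where c: "\<And>n m v.
      L_op Y \<omega> n (L_op Y \<omega> m v) - L_op Y \<omega> m (L_op Y \<omega> n v) =
      of_int (n - m) *\<^sub>R L_op Y \<omega> (n + m) v
      + (if n + m = 0 then (1 / 12 * of_int (n ^ 3 - n) * c) *\<^sub>R v else 0)"
    using virasoro by blast
  have "Y b 1 b \<in> V 0"
    by (rule Y_in[OF J1_D(1)[OF b] J1_D(1)[OF b]]) simp
  then obtain \<beta> where \<beta>: "Y b 1 b = \<beta> *\<^sub>R vac"
    by (rule V_zeroE)
  have lin: "linear (L_op Y \<omega> n)" for n
    unfolding L_op_def using linear_Y by simp
  show "\<exists>c::real. \<forall>n m v.
      L_op Y (\<omega> + T b) n (L_op Y (\<omega> + T b) m v) - L_op Y (\<omega> + T b) m (L_op Y (\<omega> + T b) n v) =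
      of_int (n - m) *\<^sub>R L_op Y (\<omega> + T b) (n + m) v
      + (if n + m = 0 then (1 / 12 * of_int (n ^ 3 - n) * c) *\<^sub>R v else 0)"
  proof (intro exI allI)
    fix n m v
    have "L_op Y (\<omega> + T b) n (L_op Y (\<omega> + T b) m v) - L_op Y (\<omega> + T b) m (L_op Y (\<omega> + T b) n v) =
        (L_op Y \<omega> n (L_op Y \<omega> m v) - L_op Y \<omega> m (L_op Y \<omega> n v))
        + of_int (m * (m + 1) - n * (n + 1)) *\<^sub>R Y b (n + m) v
        + (if n + m = 0 then (of_int ((n + 1) * (m + 1) * n) * \<beta>) *\<^sub>R v else 0)"
    proof -
      have LL: "L_op Y (\<omega> + T b) n (L_op Y (\<omega> + T b) m v) = L_op Y \<omega> n (L_op Y \<omega> m v)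
          - q *\<^sub>R (Y b m (L_op Y \<omega> n v) - of_int m *\<^sub>R Y b (n + m) v)
          - p *\<^sub>R Y b n (L_op Y \<omega> m v) + (p * q) *\<^sub>R Y b n (Y b m v)"
        if "p = of_int (n + 1)" "q = of_int (m + 1)" for n m :: int and p q
        unfolding L that(1)[symmetric] that(2)[symmetric]
        by (simp add: linear_diff[OF lin] linear_scale[OF lin] Y_linear_simps
            L_op_J1_bracket[OF J1_D(1)[OF b]] scaleR_diff_right)
      define p q :: real where pq: "p = of_int (n + 1)" "q = of_int (m + 1)"
      have coeff: "(of_int (m * (m + 1) - n * (n + 1)) :: real) = q * of_int m - p * of_int n"
        "(of_int ((n + 1) * (m + 1) * n) :: real) = p * q * of_int n"
        by (simp_all add: pq algebra_simps)
      show ?thesis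
        unfolding LL[OF pq] LL[OF pq(2,1)] J1_J1_bracket[OF b \<beta>, of n m] coeff
        by (simp add: algebra_simps)
    qed
    also have "\<dots> = of_int (n - m) *\<^sub>R L_op Y (\<omega> + T b) (n + m) v
      + (if n + m = 0 then (1 / 12 * of_int (n ^ 3 - n) * (c - 12 * \<beta>)) *\<^sub>R v else 0)"
    proof -
      have 1: "of_int (m * (m + 1) - n * (n + 1)) *\<^sub>R Y b (n + m) v =
          - (of_int (n - m) *\<^sub>R of_int (n + m + 1) *\<^sub>R Y b (n + m) v)"
        by (simp add: algebra_simps)
      have 2: "(if n + m = 0 then (1 / 12 * of_int (n ^ 3 - n) * c) *\<^sub>R v else 0)
          + (if n + m = 0 then (of_int ((n + 1) * (m + 1) * n) * \<beta>) *\<^sub>R v else 0)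
          = (if n + m = 0 then (1 / 12 * of_int (n ^ 3 - n) * (c - 12 * \<beta>)) *\<^sub>R v else 0)"
      proof (cases "n + m = 0")
        case True
        then have "m = - n" by simp
        then have "1 / 12 * of_int (n ^ 3 - n) * (c - 12 * \<beta>)
            = 1 / 12 * of_int (n ^ 3 - n) * c + of_int ((n + 1) * (m + 1) * n) * \<beta>"
          by (simp add: field_simps power3_eq_cube)
        with True show ?thesis
          by (simp only: if_True simp_thms scaleR_add_left)
      qed simp
      show ?thesis
        unfolding c 1 L 2[symmetric] by (simp only: scaleR_diff_right) simp
    qed
    finally show "L_op Y (\<omega> + T b) n (L_op Y (\<omega> + T b) m v) - L_op Y (\<omega> + T b) m (L_op Y (\<omega> + T b) n v) =
      of_int (n - m) *\<^sub>R L_op Y (\<omega> + T b) (n + m) v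
      + (if n + m = 0 then (1 / 12 * of_int (n ^ 3 - n) * (c - 12 * \<beta>)) *\<^sub>R v else 0)" .
  qed
qed

lemma expD_J1_omega_plus_T:
  assumes "a \<in> J1 Y V" "b \<in> J1 Y V"
  shows "expD (Y a 1) (\<omega> + T b) = (1 / 2) *\<^sub>R Y a 1 a + a + \<omega> + T b"
  by (simp add: linear_add[OF Aut_D(1)[OF expD_J1_Aut[OF assms(1)]]] expD_J1_omega[OF assms(1)]
      expD_J1_T[OF assms(1) J1_D(1)[OF assms(2)]] algebra_simps)

lemma J1_in_CV:
  assumes "a \<in> J1 Y V" "b \<in> J1 Y V"
  shows "(1 / 2) *\<^sub>R Y a 1 a + a + \<omega> + T b \<in> CV Y vac"
  using conformal_vertex_algebra.Aut_omega_in_CV[OF conformal_omega_plus_T[OF assms(2)] expD_J1_Aut[OF assms(1)]]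
  by (simp add: expD_J1_omega_plus_T[OF assms])

end

section \<open>Positive definite invariant forms\<close>

text \<open>Orthogonal projection to a finite-dimensional subspace; the form need not be symmetric.\<close>

lemma orthogonal_projection_exists:
  fixes B :: "'v::real_vector \<Rightarrow> 'v \<Rightarrow> real"
  assumes B: "bilinear B" "positive_definite B" and "finite S"
  shows "\<exists>w\<in>span S. \<forall>x\<in>span S. B (v - w) x = 0"
proof -
  note [simp] = bilinear_ladd[OF B(1)] bilinear_radd[OF B(1)] bilinear_lmul[OF B(1)] bilinear_rmul[OF B(1)]
    bilinear_lsub[OF B(1)] bilinear_rsub[OF B(1)] bilinear_lzero[OF B(1)] bilinear_rzero[OF B(1)]
  have ext: "\<forall>x\<in>span A. B u x = 0" if "\<forall>x\<in>A. B u x = 0" for A u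
  proof
    fix x assume "x \<in> span A"
    then show "B u x = 0"
      by (induction rule: span_induct_alt) (use that in auto)
  qed
  have "\<exists>w\<in>span S. \<forall>x\<in>S. B (v - w) x = 0"
    using \<open>finite S\<close>
  proof (induction S arbitrary: v)
    case empty
    then show ?case by (auto simp: span_zero)
  next
    case (insert s S)
    obtain w where w: "w \<in> span S" "\<forall>x\<in>S. B (v - w) x = 0"
      using insert.IH by blast
    obtain r where r: "r \<in> span S" "\<forall>x\<in>S. B (s - r) x = 0"
      using insert.IH by blast
    show ?case
    proof (cases "s = r")
      case True
      then have "B (v - w) s = 0"
        using ext[OF w(2)] r(1) by blast
      then show ?thesis
        using w span_mono[of S "insert s S"] by (intro bexI[of _ w]) auto
    next
      case False
      \<comment> \<open>The vector \<open>s - r\<close> is orthogonal to \<open>S\<close>, so \<open>B (s - r) s = B (s - r) (s - r)\<close>.\<close>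
      have "B (s - r) r = 0"
        using ext[OF r(2)] r(1) by blast
      then have "B (s - r) s = B (s - r) (s - r)"
        by simp
      also have "\<dots> > 0"
        using False B(2) unfolding positive_definite_def by (metis right_minus_eq)
      finally have nz: "B (s - r) s \<noteq> 0" by simp
      define t where "t = B (v - w) s / B (s - r) s"
      have t: "B (v - (w + t *\<^sub>R (s - r))) x = B (v - w) x - t * B (s - r) x" for x
        by (simp add: algebra_simps)
      have "w \<in> span (insert s S)" "s - r \<in> span (insert s S)"
        using w(1) r(1) span_mono[of S "insert s S"] by (auto intro: span_diff span_base)
      then have "w + t *\<^sub>R (s - r) \<in> span (insert s S)"
        by (intro span_add span_scale)
      moreover have "B (v - (w + t *\<^sub>R (s - r))) x = 0" if "x \<in> insert s S" for x
        unfolding t using that w(2) r(2) nz by (auto simp: t_def)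
      ultimately show ?thesis by blast
    qed
  qed
  then show ?thesis
    using ext by blast
qed

locale positive_voa = voa_strong_CFT_type Y vac V \<omega>
  for Y :: "'v::real_vector \<Rightarrow> int \<Rightarrow> 'v \<Rightarrow> 'v"
    and vac :: 'v and V :: "int \<Rightarrow> 'v set" and \<omega> :: 'v +
  fixes B :: "'v \<Rightarrow> 'v \<Rightarrow> real"
  assumes invariant_B: "invariant_form Y V \<omega> B"
    and positive_B: "positive_definite B"
begin

lemma bilinear_B: "bilinear B"
  using invariant_B by (simp add: invariant_form_def)

lemmas B_simps =
  bilinear_ladd[OF bilinear_B] bilinear_radd[OF bilinear_B]
  bilinear_lmul[OF bilinear_B] bilinear_rmul[OF bilinear_B]
  bilinear_lsub[OF bilinear_B] bilinear_rsub[OF bilinear_B]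
  bilinear_lneg[OF bilinear_B] bilinear_rneg[OF bilinear_B]
  bilinear_lzero[OF bilinear_B] bilinear_rzero[OF bilinear_B]

lemma B_pos: "v \<noteq> 0 \<Longrightarrow> 0 < B v v"
  using positive_B by (simp add: positive_definite_def)

lemma B_nonneg: "0 \<le> B v v"
  using B_pos[of v] by (cases "v = 0") (auto simp: B_simps)

lemma B_eq_0: "B v v = 0 \<Longrightarrow> v = 0"
  using B_pos[of v] by fastforce

text \<open>For a vector killed by \<open>L(1)\<close> the invariance condition has a single term.\<close>

lemma B_invariant_primary:
  assumes p: "p \<in> V k" "Y \<omega> 2 p = 0"
  shows "B (Y p n u) v = (-1) powi k * B u (Y p (2 * k - n - 2) v)"
proof -
  have L: "L_op Y \<omega> 1 p = 0"
    using p(2) by (simp add: L_op_def)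
  have L0: "(L_op Y \<omega> 1 ^^ i) 0 = 0" for i
    by (induction i) (simp_all add: L_op_def)
  have Li: "(L_op Y \<omega> 1 ^^ i) p = 0" if "i \<noteq> 0" for i
    using that L0 by (cases i) (simp_all add: funpow_Suc_right L del: funpow.simps)
  have "B (Y p n u) v = Sum_any (\<lambda>i::nat. (-1) powi k / fact i *
          B u (Y ((L_op Y \<omega> 1 ^^ i) p) (2 * k - n - 2 - int i) v))"
    using invariant_B p(1) unfolding invariant_form_def by blast
  also have "\<dots> = (\<Sum>i\<in>{0}. (-1) powi k / fact i *
          B u (Y ((L_op Y \<omega> 1 ^^ i) p) (2 * k - n - 2 - int i) v))"
    by (rule Sum_any.expand_superset) (auto, metis Li Y_zero(2) B_simps(10))
  finally show ?thesis by simp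
qed

text \<open>The adjoint of \<open>L(n)\<close> is \<open>L(-n)\<close>.\<close>

lemma B_omega: "B (Y \<omega> n u) v = B u (Y \<omega> (2 - n) v)"
  using B_invariant_primary[OF omega_degree L1_omega, of n u v] by simp

lemma B_T_left: "B (T u) v = B u (Y \<omega> 2 v)"
  using B_omega[of 0 u v] by (simp add: omega_0)

lemma B_T_right: "B u (T v) = B (Y \<omega> 2 u) v"
  using B_omega[of 2 u v] by (simp add: omega_0)

lemma B_vac_T: "B vac (T v) = 0"
  by (simp add: B_T_right vac_right B_simps)

lemma B_vac_homogeneous:
  assumes "v \<in> V n" "n \<noteq> 0"
  shows "B vac v = 0"
  using B_omega[of 1 vac v] assms by (simp add: vac_right B_simps omega_1)

text \<open>For \<open>v \<in> V\<^sub>n\<close> the relation \<open>[L(1), T] = 2 L(0)\<close> gives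
  \<open>B (L(1)Tv) v = 2n B v v + B (L(1)v) (L(1)v)\<close>.\<close>

lemma T_eq_0:
  assumes v: "v \<in> V n" and "n \<ge> 1" "T v = 0"
  shows "v = 0"
proof -
  have "0 = B (Y \<omega> 2 (T v)) v"
    by (simp add: assms(3) B_simps)
  also have "\<dots> = 2 * of_int n * B v v + B (Y \<omega> 2 v) (Y \<omega> 2 v)"
    by (simp add: L1_T[OF v] B_simps B_T_left)
  finally have "2 * of_int n * B v v \<le> 0"
    using B_nonneg[of "Y \<omega> 2 v"] by simp
  with \<open>n \<ge> 1\<close> have "B v v \<le> 0"
    by (simp add: mult_le_0_iff)
  then show ?thesis
    using B_pos[of v] by fastforce
qed

text \<open>Since \<open>L(1)\<close> is adjoint to \<open>T\<close>, a vector orthogonal to \<open>T V\<^sub>n\<close> is killed by \<open>L(1)\<close>.\<close>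

lemma primary_decomposition:
  assumes x: "x \<in> V (n + 1)"
  obtains p z where "p \<in> V (n + 1)" "Y \<omega> 2 p = 0" "z \<in> V n" "x = p + T z"
proof -
  obtain S where S: "finite S" "V n = span S"
    using finite_dim by blast
  have TS: "span (T ` S) = T ` V n"
    by (simp add: S(2) linear_span_image[OF linear_T])
  obtain w where w: "w \<in> T ` V n" "\<forall>y\<in>T ` V n. B (x - w) y = 0"
    using orthogonal_projection_exists[OF bilinear_B positive_B, of "T ` S" x] S(1) TS by auto
  then obtain z where z: "z \<in> V n" "w = T z" by blast
  have p: "x - w \<in> V (n + 1)"
    using x T_in[OF z(1)] z(2) by (simp add: subspace_diff[OF subspace_V])
  have "Y \<omega> 2 (x - w) \<in> V n"
    by (rule Y_in[OF omega_degree p]) simp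
  then have "B (Y \<omega> 2 (x - w)) (Y \<omega> 2 (x - w)) = 0"
    using w(2) by (simp flip: B_T_right)
  then have "Y \<omega> 2 (x - w) = 0"
    by (rule B_eq_0)
  with p z show ?thesis
    by (intro that[of "x - w" z]) auto
qed

text \<open>The bilinear form \<open>(u, v) \<mapsto> B \<one> (u(n)v)\<close>, where \<open>n\<close> makes \<open>u(n)v\<close> of degree \<open>0\<close>, is the
  coefficient of the two-point function of \<open>u\<close> and \<open>v\<close>. It is symmetric up to sign because in
  the skew symmetry formula \<open>v(i)u\<close> has negative degree for \<open>i > n\<close>.\<close>

lemma two_point_symmetric:
  assumes u: "u \<in> V h" and v: "v \<in> V k" and n: "n = h + k - 1" "n \<ge> 0"
  shows "Y u n v = - ((-1) ^ nat n) *\<^sub>R Y v n u"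
proof -
  have "Y u n v = - (\<Sum>i<Suc (nat n). ((-1) ^ i) *\<^sub>R Y (Y v (int i) u) (n - 1 - int i) vac)"
    by (rule skew_symmetry[OF n(2)]) (use Y_eq_0[OF v u] n in auto)
  also have "(\<Sum>i<Suc (nat n). ((-1) ^ i) *\<^sub>R Y (Y v (int i) u) (n - 1 - int i) vac)
      = (\<Sum>i\<in>{nat n}. ((-1) ^ i) *\<^sub>R Y (Y v (int i) u) (n - 1 - int i) vac)"
    by (rule sum.mono_neutral_right) (use n(2) in \<open>auto intro!: vac_right\<close>)
  finally show ?thesis
    using n(2) by (simp add: creation)
qed

lemma two_point_T_right: "B vac (Y u n (T v)) = of_int n * B vac (Y u (n - 1) v)"
proof -
  have "T (Y u n v) = Y (T u) n v + Y u n (T v)"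
    using zero_mode_derivation[of \<omega> u n v] by (simp add: omega_0)
  then have "Y u n (T v) = T (Y u n v) + of_int n *\<^sub>R Y u (n - 1) v"
    by (simp add: Y_T_left algebra_simps)
  then show ?thesis
    by (simp add: B_simps B_vac_T)
qed

text \<open>On \<open>V\<^sub>H\<close> the two-point form has sign \<open>(-1)\<^sup>H\<close>. For \<open>u = p + Tz\<close> with \<open>L(1)p = 0\<close> the cross terms
  vanish, the term of \<open>p\<close> is \<open>\<plusminus>B(p, p)\<close>, and moving both translations out of the term of \<open>Tz\<close> gives
  \<open>-(2H - 1)(2H - 2)\<close> times the term of \<open>z\<close>.\<close>

lemma two_point_pos:
  assumes "u \<in> V (int h)" "u \<noteq> 0"
  shows "0 < (-1) ^ h * B vac (Y u (2 * int h - 1) u)"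
  using assms
proof (induction h arbitrary: u)
  case 0
  then have "u \<in> V 0" by simp
  then obtain c where c: "u = c *\<^sub>R vac"
    by (rule V_zeroE)
  with 0 have "B vac vac > 0" "c \<noteq> 0"
    by (auto intro: B_pos)
  then show ?case
    by (simp add: c Y_linear_simps vac_left B_simps flip: power2_eq_square mult.assoc)
next
  case (Suc h)
  define n where "n = 2 * int (Suc h) - 1"
  have u: "u \<in> V (int h + 1)"
    using Suc.prems(1) by (simp add: add.commute)
  obtain p z where pz: "p \<in> V (int h + 1)" "Y \<omega> 2 p = 0" "z \<in> V (int h)" "u = p + T z"
    using primary_decomposition[OF u] .
  have p: "B p v = (-1) ^ Suc h * B vac (Y p n v)" for v
    using B_invariant_primary[OF pz(1,2), of "-1" vac v]
    by (simp add: creation n_def power_int_add algebra_simps)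
  have pTz: "B vac (Y p n (T z)) = 0"
    using p[of "T z"] pz(2) by (simp add: B_T_right B_simps)
  have "Y (T z) n p = - ((-1) ^ nat n) *\<^sub>R Y p n (T z)"
    by (rule two_point_symmetric[OF T_in[OF pz(3)] pz(1)]) (simp_all add: n_def)
  then have Tzp: "B vac (Y (T z) n p) = 0"
    by (simp add: B_simps pTz)
  have *: "B vac (Y (T z) n (T z)) = - (of_int n * of_int (n - 1) * B vac (Y z (n - 2) z))"
    by (simp add: Y_T_left B_simps two_point_T_right)
  have "n - 2 = 2 * int h - 1"
    by (simp add: n_def)
  then have TzTz: "(-1) ^ Suc h * B vac (Y (T z) n (T z))
      = of_int n * of_int (n - 1) * ((-1) ^ h * B vac (Y z (2 * int h - 1) z))"
    unfolding * by simp
  have "(-1) ^ Suc h * B vac (Y u n u) = B p p + (-1) ^ Suc h * B vac (Y (T z) n (T z))"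
    unfolding p[of p] by (simp add: pz(4) Y_linear_simps B_simps pTz Tzp algebra_simps)
  then have eq: "(-1) ^ Suc h * B vac (Y u n u)
      = B p p + of_int n * of_int (n - 1) * ((-1) ^ h * B vac (Y z (2 * int h - 1) z))"
    by (simp only: TzTz)
  have z_nonneg: "0 \<le> (-1) ^ h * B vac (Y z (2 * int h - 1) z)"
    using Suc.IH[OF pz(3)] by (cases "z = 0") (auto simp: B_simps)
  have n: "real_of_int n * real_of_int (n - 1) = (2 * real h + 1) * (2 * real h)"
    by (simp add: n_def)
  show ?case
  proof (cases "p = 0")
    case False
    then have "0 < B p p" by (rule B_pos)
    then show ?thesis
      using z_nonneg unfolding n_def[symmetric] eq n by (simp add: add_pos_nonneg)
  next
    case True
    with Suc.prems(2) pz(4) have "T z \<noteq> 0" by simp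
    then have "z \<noteq> 0"
      using linear_0[OF linear_T] by auto
    have "h \<noteq> 0"
    proof
      assume "h = 0"
      with pz(3) have "z \<in> V 0" by simp
      then obtain c where "z = c *\<^sub>R vac" by (rule V_zeroE)
      with \<open>T z \<noteq> 0\<close> show False
        by (simp add: linear_scale[OF linear_T] T_vac)
    qed
    then show ?thesis
      using Suc.IH[OF pz(3) \<open>z \<noteq> 0\<close>] unfolding n_def[symmetric] eq n
      by (simp add: True B_simps)
  qed
qed

lemma two_point_eq_0:
  assumes "u \<in> V h" "B vac (Y u (2 * h - 1) u) = 0"
  shows "u = 0"
proof (cases "h < 0")
  case True
  then show ?thesis using assms(1) V_neg by blast
next
  case False
  then show ?thesis
    using two_point_pos[of u "nat h"] assms by fastforce
qed

text \<open>The zero mode of a vector of positive degree has its image orthogonal to \<open>\<one>\<close>. Being a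
  derivation, it is therefore skew for the two-point form. As that form is definite on each \<open>V\<^sub>m\<close>, the
  operator has no nilpotent part on homogeneous vectors, and no nonzero real eigenvalue if it preserves the
  degree.\<close>

lemma B_vac_zero_mode:
  assumes z: "z \<in> V d" and "d \<ge> 1"
  shows "B vac (Y z 0 w) = 0"
proof (rule linear_eq_on_homogeneous[where f = "\<lambda>w. B vac (Y z 0 w)" and g = "\<lambda>_. 0"])
  show "linear (\<lambda>w. B vac (Y z 0 w))"
    by (rule linearI) (simp_all add: Y_linear_simps B_simps)
  show "linear (\<lambda>_::'v. 0::real)"
    by (rule linear_zero)
next
  fix m v assume v: "v \<in> V m"
  show "B vac (Y z 0 v) = 0"
  proof (cases "d + m - 1 = 0")
    case False
    have "Y z 0 v \<in> V (d + m - 1)"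
      by (rule Y_in[OF z v]) simp
    with False show ?thesis
      by (rule B_vac_homogeneous[rotated])
  next
    case True
    have "Y z 0 v = 0"
    proof (cases "m = 0")
      case True
      then obtain c where "v = c *\<^sub>R vac"
        using v V_zeroE by metis
      then show ?thesis
        by (simp add: Y_linear_simps vac_right)
    next
      case False
      with True \<open>d \<ge> 1\<close> have "m < 0" by linarith
      then show ?thesis
        using V_neg[OF v] by simp
    qed
    then show ?thesis
      by (simp add: B_simps)
  qed
qed

lemma zero_mode_skew:
  assumes "z \<in> V d" "d \<ge> 1"
  shows "B vac (Y (Y z 0 a) n b) = - B vac (Y a n (Y z 0 b))"
  using B_vac_zero_mode[OF assms, of "Y a n b"] zero_mode_derivation[of z a n b]
  by (simp add: B_simps)

lemma zero_mode_square:
  assumes z: "z \<in> V d" "d \<ge> 1" and w: "w \<in> V m" and "Y z 0 (Y z 0 w) = 0"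
  shows "Y z 0 w = 0"
proof (rule two_point_eq_0)
  show "Y z 0 w \<in> V (d + m - 1)"
    by (rule Y_in[OF z(1) w]) simp
  show "B vac (Y (Y z 0 w) (2 * (d + m - 1) - 1) (Y z 0 w)) = 0"
    using zero_mode_skew[OF z, of w _ "Y z 0 w"] assms(4) by (simp add: B_simps)
qed

lemma zero_mode_eigenvalue:
  assumes z: "z \<in> V 1" and w: "w \<in> V m" and "Y z 0 w = \<mu> *\<^sub>R w"
  shows "Y z 0 w = 0"
proof -
  have "\<mu> * B vac (Y w (2 * m - 1) w) = - (\<mu> * B vac (Y w (2 * m - 1) w))"
    using zero_mode_skew[OF z, of w "2 * m - 1" w] assms(3) by (simp add: Y_linear_simps B_simps)
  then have "\<mu> = 0 \<or> B vac (Y w (2 * m - 1) w) = 0"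
    by auto
  then have "\<mu> = 0 \<or> w = 0"
    using two_point_eq_0[OF w] by blast
  then show ?thesis
    using assms(3) by auto
qed

text \<open>Skew symmetry expresses \<open>x(0)\<omega>\<close> as \<open>(n - 1) T x\<close> plus a vector in the image of \<open>T\<^sup>2\<close>, and \<open>T\<close> is
  injective in positive degree.\<close>

lemma zero_mode_eq_0_imp_T_image:
  assumes x: "x \<in> V n" and "n \<ge> 2" and "Y x 0 \<omega> = 0"
  obtains z where "z \<in> V (n - 1)" "x = T z"
proof -
  define N where "N = nat n"
  have T_Y: "Y y (- 1 - int i) vac = (1 / real i) *\<^sub>R T (Y y (- int i) vac)" if "i \<noteq> 0" for y i
  proof -
    have "T (Y y (- int i) vac) = Y (T y) (- int i) vac"
      using zero_mode_derivation[of \<omega> y "- int i" vac] by (simp add: omega_0 T_vac)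
    also have "\<dots> = real i *\<^sub>R Y y (- int i - 1) vac"
      by (simp add: Y_T_left)
    also have "- int i - 1 = - 1 - int i"
      by simp
    finally show ?thesis
      using that by simp
  qed
  define g where "g i = ((-1) ^ i) *\<^sub>R Y (Y \<omega> (int i) x) (0 - 1 - int i) vac" for i
  define h where "h i = ((-1) ^ i * (1 / real i) * (1 / real (i - 1))) *\<^sub>R Y (Y \<omega> (int i) x) (1 - int i) vac" for i
  have gh: "g (i + 2) = T (T (h (i + 2)))" for i
    using T_Y[of "i + 2" "Y \<omega> (int (i + 2)) x"] T_Y[of "i + 1" "Y \<omega> (int (i + 2)) x"]
    by (simp add: g_def h_def linear_scale[OF linear_T])
  have "0 = Y x 0 \<omega>"
    by (simp add: assms(3))
  also have "\<dots> = - (\<Sum>i<Suc (Suc N). g i)"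
    unfolding g_def
    by (rule skew_symmetry) (use Y_eq_0[OF omega_degree x] \<open>n \<ge> 2\<close> in \<open>auto simp: N_def\<close>)
  also have "(\<Sum>i<Suc (Suc N). g i) = g 0 + g 1 + (\<Sum>i<N. g (i + 2))"
    by (simp add: sum.lessThan_Suc_shift del: sum.lessThan_Suc)
  also have "g 0 = T x"
    by (simp add: g_def omega_0 creation)
  also have "g 1 = - (of_int n *\<^sub>R T x)"
    by (simp add: g_def omega_1[OF x] Y_linear_simps translation_def)
  also have "(\<Sum>i<N. g (i + 2)) = T (T (\<Sum>i<N. h (i + 2)))"
    by (simp only: gh linear_sum[OF linear_T])
  finally have "T (T (\<Sum>i<N. h (i + 2)) - of_int (n - 1) *\<^sub>R x) = 0"
    by (simp add: linear_diff[OF linear_T] linear_add[OF linear_T] linear_scale[OF linear_T] algebra_simps)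
  then obtain y where y: "T (T y - of_int (n - 1) *\<^sub>R x) = 0"
    by blast
  have pT: "pr k (T v) = T (pr (k - 1) v)" for k v
    by (rule pr_shift[OF linear_T T_in])
  define u where "u = T (pr (n - 1) y) - of_int (n - 1) *\<^sub>R x"
  have "pr n (T y - of_int (n - 1) *\<^sub>R x) = u"
    using x by (simp add: u_def pr_linear_simps pT pr_homogeneous)
  then have "T u = pr (n + 1) (T (T y - of_int (n - 1) *\<^sub>R x))"
    by (simp add: pT)
  then have "T u = 0"
    by (simp only: y linear_0[OF linear_pr])
  moreover have "u \<in> V n"
    using T_in[OF pr_in, of "n - 1" y] x by (simp add: u_def subspace_diff subspace_scale subspace_V)
  ultimately have "u = 0"
    using T_eq_0 \<open>n \<ge> 2\<close> by simp
  then have "x = (1 / of_int (n - 1)) *\<^sub>R T (pr (n - 1) y)"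
    using \<open>n \<ge> 2\<close> by (simp add: u_def)
  also have "\<dots> = T ((1 / of_int (n - 1)) *\<^sub>R pr (n - 1) y)"
    by (simp add: linear_scale[OF linear_T])
  finally show ?thesis
    using that subspace_scale[OF subspace_V pr_in] by blast
qed

end

section \<open>Classification of the conformal vectors\<close>

context positive_voa
begin

lemma CV_zero_mode:
  assumes "w \<in> CV Y vac"
  shows "Y (pr n w) 0 v = (if n = 2 then T v else 0)"
proof -
  interpret W: conformal_vertex_algebra Y vac "\<lambda>n. {v. Y w 1 v = of_int n *\<^sub>R v}" w
    using assms by (simp add: CV_def)
  show ?thesis
  proof (rule linear_eq_on_homogeneous[where f = "Y (pr n w) 0" and g = "\<lambda>v. if n = 2 then T v else 0"])
    show "linear (\<lambda>v. if n = 2 then T v else 0)"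
      using linear_T linear_zero by (cases "n = 2") simp_all
  next
    fix m v assume v: "v \<in> V m"
    have "Y (pr n w) 0 v = pr (n + m - 1) (Y w 0 v)"
      using pr_Y_left[OF v, of "n + m - 1" w 0] by simp
    also have "\<dots> = pr (n + m - 1) (T v)"
      by (simp add: W.omega_0)
    also have "\<dots> = (if n = 2 then T v else 0)"
      by (simp add: pr_homogeneous[OF T_in[OF v]])
    finally show "Y (pr n w) 0 v = (if n = 2 then T v else 0)" .
  qed (rule linear_Y)
qed

lemma CV_component:
  assumes w: "w \<in> CV Y vac" and "n \<ge> 2"
  obtains z where "z \<in> V (n - 1)" "pr n w = (if n = 2 then \<omega> else 0) + T z"
proof -
  let ?x = "pr n w - (if n = 2 then \<omega> else 0)"
  have "?x \<in> V n"
    using pr_in[of n w] omega_degree by (auto simp: subspace_diff[OF subspace_V])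
  moreover have "Y ?x 0 \<omega> = 0"
    using CV_zero_mode[OF w, of n \<omega>] by (simp add: Y_linear_simps omega_0)
  ultimately obtain z where "z \<in> V (n - 1)" "?x = T z"
    using zero_mode_eq_0_imp_T_image \<open>n \<ge> 2\<close> by blast
  then show ?thesis
    using that by (metis add.commute diff_add_cancel)
qed

lemma CV_mode_1_pr:
  "pr i (Y w 1 (pr k v)) = Y (pr (i - k + 2) w) 1 (pr k v)"
  using pr_Y_left[OF pr_in, of i w 1 k v] by (simp add: add.commute)

text \<open>Let \<open>N \<ge> 2\<close> be a degree above which all components \<open>w\<^sub>n\<close> of \<open>w\<close> have \<open>w\<^sub>n(1) = 0\<close>, and let \<open>-z(0)\<close> be
  the difference of \<open>w\<^sub>N(1)\<close> and the part of degree \<open>N - 2\<close> of \<open>L(0)\<close>. If \<open>v\<close> is a sum of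
  eigenvectors of \<open>w(1)\<close>, then applying \<open>w(1) - \<nu>\<close> acts on the highest component of \<open>v\<close> as a scalar
  (zero if \<open>N > 2\<close>) minus \<open>z(0)\<close>, and removes one eigenvector. By induction on the number of eigenvectors and skewness of \<open>z(0)\<close>, this component is killed by \<open>z(0)\<close>.\<close>

lemma CV_top_component:
  assumes z: "z \<in> V (N - 1)" "N \<ge> 2"
    and xN: "\<And>v. Y (pr N w) 1 v = (if N = 2 then Y \<omega> 1 v else 0) - Y z 0 v"
    and above: "\<And>n v. n > N \<Longrightarrow> Y (pr n w) 1 v = 0"
    and "finite \<Lambda>"
    and "\<And>\<nu>. \<nu> \<in> \<Lambda> \<Longrightarrow> Y w 1 (g \<nu>) = of_int \<nu> *\<^sub>R g \<nu>"
    and "\<And>i. i > j \<Longrightarrow> pr i (\<Sum>\<nu>\<in>\<Lambda>. g \<nu>) = 0"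
  shows "Y z 0 (pr j (\<Sum>\<nu>\<in>\<Lambda>. g \<nu>)) = 0"
  using assms(5-)
proof (induction \<Lambda> arbitrary: g j)
  case empty
  then show ?case by (simp add: pr_linear_simps)
next
  case (insert l \<Lambda>)
  define v where "v = (\<Sum>\<nu>\<in>insert l \<Lambda>. g \<nu>)"
  define v' where "v' = Y w 1 v - of_int l *\<^sub>R v"
  define e where "e = N - 2"
  have e: "e \<ge> 0" using z(2) by (simp add: e_def)
  have v: "pr i v = 0" if "i > j" for i
    using insert.prems(2) that by (simp add: v_def)
  have v': "v' = (\<Sum>\<nu>\<in>\<Lambda>. of_int (\<nu> - l) *\<^sub>R g \<nu>)"
    using insert.hyps insert.prems(1)
    by (simp add: v'_def v_def linear_sum[OF linear_Y] Y_linear_simps scaleR_add_right scaleR_sum_right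
        scaleR_diff_left flip: sum_subtractf)
  have expand: "pr i (Y w 1 v) = (if i = j + e then Y (pr N w) 1 (pr j v) else 0)" if "i \<ge> j + e" for i
  proof -
    let ?S = "insert j {k. pr k v \<noteq> 0}"
    have "pr i (Y w 1 v) = (\<Sum>k\<in>?S. pr i (Y w 1 (pr k v)))"
      by (rule pr_linear_expand[OF linear_Y]) (auto simp: finite_pr)
    also have "\<dots> = (\<Sum>k\<in>?S. if k = j \<and> i = j + e then Y (pr N w) 1 (pr j v) else 0)"
    proof (rule sum.cong[OF refl])
      fix k assume "k \<in> ?S"
      then have "k \<le> j"
        using v[of k] not_le by auto
      show "pr i (Y w 1 (pr k v)) = (if k = j \<and> i = j + e then Y (pr N w) 1 (pr j v) else 0)"
      proof (cases "k = j \<and> i = j + e")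
        case True
        then have "i - k + 2 = N" by (simp add: e_def)
        with True show ?thesis by (simp add: CV_mode_1_pr)
      next
        case False
        then have "i - k + 2 > N"
          using \<open>k \<le> j\<close> that by (auto simp: e_def)
        then have "pr i (Y w 1 (pr k v)) = 0"
          by (simp add: CV_mode_1_pr above)
        with False show ?thesis
          by (simp only: if_False)
      qed
    qed
    also have "\<dots> = (if i = j + e then Y (pr N w) 1 (pr j v) else 0)"
      by (cases "i = j + e") (simp_all add: finite_pr)
    finally show ?thesis .
  qed
  define \<mu> :: real where "\<mu> = (if N = 2 then of_int (j - l) else 0)"
  have top: "pr (j + e) v' = \<mu> *\<^sub>R pr j v - Y z 0 (pr j v)"
    using v[of "j + e"] e
    by (auto simp: v'_def pr_linear_simps expand xN \<mu>_def e_def omega_1[OF pr_in] scaleR_diff_left)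
  have "Y z 0 (pr (j + e) v') = 0"
    unfolding v'
  proof (rule insert.IH)
    fix \<nu> assume "\<nu> \<in> \<Lambda>"
    then show "Y w 1 (of_int (\<nu> - l) *\<^sub>R g \<nu>) = of_int \<nu> *\<^sub>R of_int (\<nu> - l) *\<^sub>R g \<nu>"
      using insert.prems(1) by (simp add: Y_linear_simps)
  next
    fix i assume "i > j + e"
    then have "pr i v' = 0"
      using v[of i] e by (simp add: v'_def pr_linear_simps expand)
    then show "pr i (\<Sum>\<nu>\<in>\<Lambda>. of_int (\<nu> - l) *\<^sub>R g \<nu>) = 0"
      by (simp add: v')
  qed
  then have eig: "Y z 0 (Y z 0 (pr j v)) = \<mu> *\<^sub>R Y z 0 (pr j v)"
    by (simp add: top Y_linear_simps)
  have "Y z 0 (Y z 0 (pr j v)) = 0"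
  proof (cases "N = 2")
    case True
    then have "z \<in> V 1" using z(1) by simp
    moreover have "Y z 0 (pr j v) \<in> V j"
      by (rule Y_in[OF \<open>z \<in> V 1\<close> pr_in]) simp
    ultimately show ?thesis
      using zero_mode_eigenvalue eig by blast
  next
    case False
    then show ?thesis using eig by (simp add: \<mu>_def)
  qed
  then have "Y z 0 (pr j v) = 0"
    using zero_mode_square[OF z(1) _ pr_in] z(2) by simp
  then show ?case
    by (simp add: v_def)
qed

lemma CV_mode_1:
  assumes w: "w \<in> CV Y vac" and "n \<ge> 2"
  shows "Y (pr n w) 1 v = (if n = 2 then Y \<omega> 1 v else 0)"
proof -
  interpret W: conformal_vertex_algebra Y vac "\<lambda>n. {v. Y w 1 v = of_int n *\<^sub>R v}" w
    using w by (simp add: CV_def)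
  define E where "E = {n. n \<ge> 2 \<and> (\<exists>v. Y (pr n w) 1 v \<noteq> (if n = 2 then Y \<omega> 1 v else 0))}"
  have "E \<subseteq> insert 2 {n. pr n w \<noteq> 0}"
    by (auto simp: E_def)
  then have "finite E"
    by (rule finite_subset) (simp add: finite_pr)
  have "E = {}"
  proof (rule ccontr)
    assume "E \<noteq> {}"
    define N where "N = Max E"
    have N: "N \<in> E"
      unfolding N_def by (rule Max_in[OF \<open>finite E\<close> \<open>E \<noteq> {}\<close>])
    then have "N \<ge> 2" by (simp add: E_def)
    have above: "Y (pr n w) 1 v = 0" if "n > N" for n v
    proof -
      have "n \<notin> E"
        using that Max_ge[OF \<open>finite E\<close>, of n] by (auto simp: N_def)
      with that \<open>N \<ge> 2\<close> show ?thesis by (auto simp: E_def)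
    qed
    obtain z where z: "z \<in> V (N - 1)" "pr N w = (if N = 2 then \<omega> else 0) + T z"
      using CV_component[OF w \<open>N \<ge> 2\<close>] .
    have xN: "Y (pr N w) 1 v = (if N = 2 then Y \<omega> 1 v else 0) - Y z 0 v" for v
      by (simp add: z(2) Y_linear_simps Y_T_left)
    have "Y z 0 v = 0" for v
    proof (rule linear_eq_on_homogeneous[where f = "Y z 0" and g = "\<lambda>_. 0"])
      fix m v assume v: "v \<in> V m"
      have sum: "(\<Sum>\<nu>\<in>{\<nu>. W.pr \<nu> v \<noteq> 0}. W.pr \<nu> v) = v"
        by (rule W.sum_pr[OF W.finite_pr order_refl])
      have "Y z 0 (pr m (\<Sum>\<nu>\<in>{\<nu>. W.pr \<nu> v \<noteq> 0}. W.pr \<nu> v)) = 0"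
      proof (rule CV_top_component[OF z(1) \<open>N \<ge> 2\<close> xN above W.finite_pr])
        show "Y w 1 (W.pr \<nu> v) = of_int \<nu> *\<^sub>R W.pr \<nu> v" for \<nu>
          using W.pr_in[of \<nu> v] by simp
        show "pr i (\<Sum>\<nu>\<in>{\<nu>. W.pr \<nu> v \<noteq> 0}. W.pr \<nu> v) = 0" if "i > m" for i
          unfolding sum using that by (simp add: pr_homogeneous[OF v])
      qed
      then show "Y z 0 v = 0"
        unfolding sum by (simp add: pr_homogeneous[OF v])
    qed (simp_all add: linear_Y linear_zero)
    with N show False
      by (simp add: E_def xN)
  qed
  then show ?thesis
    using \<open>n \<ge> 2\<close> by (auto simp: E_def)
qed

lemma CV_mode_1_eq:
  assumes w: "w \<in> CV Y vac"
  shows "Y w 1 v = Y \<omega> 1 v + Y (pr 1 w) 1 v"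
proof (rule linear_eq_on_homogeneous[where f = "Y w 1" and g = "\<lambda>v. Y \<omega> 1 v + Y (pr 1 w) 1 v"])
  show "linear (\<lambda>v. Y \<omega> 1 v + Y (pr 1 w) 1 v)"
    by (rule linear_compose_add[OF linear_Y linear_Y])
next
  fix m v assume v: "v \<in> V m"
  show "Y w 1 v = Y \<omega> 1 v + Y (pr 1 w) 1 v"
  proof (rule pr_eqI)
    fix i
    have "Y (pr 1 w) 1 v \<in> V (m - 1)"
      by (rule Y_in[OF pr_in v]) simp
    then have rhs: "pr i (Y \<omega> 1 v + Y (pr 1 w) 1 v) =
        (if i = m then Y \<omega> 1 v else 0) + (if i = m - 1 then Y (pr 1 w) 1 v else 0)"
      using v by (simp add: pr_linear_simps omega_1[OF v] pr_homogeneous[OF v] pr_homogeneous)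
    have lhs: "pr i (Y w 1 v) = Y (pr (i - m + 2) w) 1 v"
      using pr_Y_left[OF v, of i w 1] by (simp add: add.commute)
    consider "i \<ge> m" | "i = m - 1" | "i = m - 2" | "i < m - 2" by linarith
    then show "pr i (Y w 1 v) = pr i (Y \<omega> 1 v + Y (pr 1 w) 1 v)"
    proof cases
      case 1
      then show ?thesis
        unfolding lhs rhs using CV_mode_1[OF w, of "i - m + 2" v] by auto
    next
      case 2
      then show ?thesis unfolding lhs rhs by simp
    next
      case 3
      obtain c where "pr 0 w = c *\<^sub>R vac"
        using pr_in by (rule V_zeroE)
      with 3 show ?thesis
        unfolding lhs rhs by (simp add: Y_linear_simps vac_left)
    next
      case 4
      then have "pr (i - m + 2) w = 0"
        using V_neg[OF pr_in] by simp
      with 4 show ?thesis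
        unfolding lhs rhs by simp
    qed
  qed
qed (rule linear_Y)

theorem CV_classification:
  assumes w: "w \<in> CV Y vac"
  obtains a b where "a \<in> J1 Y V" "b \<in> J1 Y V" "w = (1 / 2) *\<^sub>R Y a 1 a + a + \<omega> + T b"
proof -
  define a where "a = pr 1 w"
  have a: "a \<in> J1 Y V"
    using CV_zero_mode[OF w, of 1] pr_in[of 1 w] by (simp add: J1_def a_def)
  obtain b where b: "b \<in> V 1" "pr 2 w = \<omega> + T b"
    using CV_component[OF w, of 2] by auto
  have "Y b 0 v = 0" for v
    using CV_mode_1[OF w, of 2 v] by (simp add: b(2) Y_linear_simps Y_T_left)
  with b(1) have bJ: "b \<in> J1 Y V"
    by (simp add: J1_def)
  have "w \<in> {v. Y w 1 v = of_int 2 *\<^sub>R v}"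
    using w unfolding CV_def by (blast dest: conformal_vertex_algebra.omega_degree)
  then have "Y w 1 w = 2 *\<^sub>R w" by simp
  \<comment> \<open>Compare the components of \<open>w(1)w = 2w\<close>, where \<open>w(1) = L(0) + a(1)\<close>.\<close>
  have comp: "2 *\<^sub>R pr i w = of_int i *\<^sub>R pr i w + Y a 1 (pr (i + 1) w)" for i
  proof -
    have "pr i (Y a 1 w) = Y a 1 (pr (i - - 1) w)"
    proof (rule pr_shift[OF linear_Y])
      fix m v assume "v \<in> V m"
      then show "Y a 1 v \<in> V (m + - 1)"
        by (rule Y_in[OF J1_D(1)[OF a]]) simp
    qed
    then have "pr i (Y w 1 w) = of_int i *\<^sub>R pr i w + Y a 1 (pr (i + 1) w)"
      by (simp add: CV_mode_1_eq[OF w, of w] pr_linear_simps pr_omega_1 flip: a_def)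
    then show ?thesis
      by (simp add: \<open>Y w 1 w = 2 *\<^sub>R w\<close> pr_linear_simps)
  qed
  have high: "pr i w = 0" if "i \<ge> 3" for i
  proof (rule ccontr)
    let ?F = "{i. i \<ge> 3 \<and> pr i w \<noteq> 0}"
    assume "pr i w \<noteq> 0"
    with that have "?F \<noteq> {}" by blast
    have F: "finite ?F"
      by (rule finite_subset[OF _ finite_pr[of w]]) auto
    define k where "k = Max ?F"
    have "k \<in> ?F"
      unfolding k_def by (rule Max_in[OF F \<open>?F \<noteq> {}\<close>])
    moreover have "k + 1 \<notin> ?F"
      using Max_ge[OF F, of "k + 1"] by (auto simp: k_def)
    ultimately have k: "k \<ge> 3" "pr k w \<noteq> 0" "pr (k + 1) w = 0"
      by auto
    then have "of_int 2 *\<^sub>R pr k w = of_int k *\<^sub>R pr k w"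
      using comp[of k] by simp
    with k show False by simp
  qed
  have "{n. pr n w \<noteq> 0} \<subseteq> {0, 1, 2}"
  proof
    fix n assume "n \<in> {n. pr n w \<noteq> 0}"
    then have "\<not> n \<ge> 3" "\<not> n < 0"
      using high V_neg[OF pr_in] by auto
    then show "n \<in> {0, 1, 2}" by auto
  qed
  then have "w = pr 0 w + (pr 1 w + pr 2 w)"
    using sum_pr[of "{0, 1, 2}" w] by simp
  moreover have "pr 0 w = (1 / 2) *\<^sub>R Y a 1 a"
    using arg_cong[OF comp[of 0], of "(*\<^sub>R) (1 / 2)"] by (simp add: a_def)
  ultimately have "w = (1 / 2) *\<^sub>R Y a 1 a + a + \<omega> + T b"
    by (simp add: b(2) add.assoc flip: a_def)
  with a bJ show ?thesis by (rule that)
qed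

end

section \<open>The automorphism group\<close>

context graded_vertex_algebra
begin

text \<open>\<open>Aut\<^sup>- V\<close> consists of the automorphisms that are unipotent for the degree filtration: \<open>f v - v\<close> has
  lower degree than \<open>v\<close>.\<close>

lemma Aut_minus_iff:
  "f \<in> Aut_minus Y vac V \<longleftrightarrow>
     f \<in> Aut Y vac \<and> (\<forall>n. \<forall>v\<in>V n. \<forall>i\<ge>n. pr i (f v - v) = 0)"
proof -
  have "f ` V n \<subseteq> span (\<Union>k\<in>{..n}. V k) \<and> (\<forall>v\<in>V n. pr n (f v) = v) \<longleftrightarrow>
      (\<forall>v\<in>V n. \<forall>i\<ge>n. pr i (f v - v) = 0)" for n
  proof (intro iffI conjI ballI allI impI subsetI)
    fix v i assume *: "f ` V n \<subseteq> span (\<Union>k\<in>{..n}. V k) \<and> (\<forall>v\<in>V n. pr n (f v) = v)"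
      and v: "v \<in> V n" and i: "n \<le> i"
    show "pr i (f v - v) = 0"
    proof (cases "i = n")
      case True
      with * v show ?thesis by (simp add: pr_linear_simps pr_homogeneous[OF v])
    next
      case False
      have "f v \<in> span (\<Union>k\<in>{..n}. V k)"
        using * v by blast
      then have "pr i (f v) = 0"
      proof (induction rule: span_induct_alt)
        case (step c x y)
        then show ?case
          using False i by (auto simp: pr_linear_simps pr_homogeneous)
      qed (simp add: pr_linear_simps)
      with False show ?thesis
        by (simp add: pr_linear_simps pr_homogeneous[OF v])
    qed
  next
    fix v assume *: "\<forall>v\<in>V n. \<forall>i\<ge>n. pr i (f v - v) = 0" and v: "v \<in> V n"
    have "pr n (f v - v) = 0" using * v by blast
    then show "pr n (f v) = v"
      by (simp add: pr_linear_simps pr_homogeneous[OF v])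
  next
    fix x assume *: "\<forall>v\<in>V n. \<forall>i\<ge>n. pr i (f v - v) = 0" and "x \<in> f ` V n"
    then obtain v where v: "v \<in> V n" "x = f v" by blast
    have "pr i x \<in> span (\<Union>k\<in>{..n}. V k)" for i
    proof (cases "i \<le> n")
      case True
      then show ?thesis using pr_in by (intro span_base) auto
    next
      case False
      then have "pr i (f v - v) = 0" using * v by simp
      with False have "pr i x = 0"
        by (simp add: v(2) pr_linear_simps pr_homogeneous[OF v(1)])
      then show ?thesis by (simp add: span_zero)
    qed
    then have "(\<Sum>i\<in>{i. pr i x \<noteq> 0}. pr i x) \<in> span (\<Union>k\<in>{..n}. V k)"
      by (rule span_sum)
    then show "x \<in> span (\<Union>k\<in>{..n}. V k)"
      using sum_pr[OF finite_pr order_refl, of x] by simp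
  qed
  then show ?thesis
    unfolding Aut_minus_def by auto
qed

lemma Aut_minus_lower:
  assumes f: "f \<in> Aut_minus Y vac V" and x: "\<And>i. i > n \<Longrightarrow> pr i x = 0" and "i \<ge> n"
  shows "pr i (f x - x) = 0"
proof -
  have "linear f"
    using f by (simp add: Aut_minus_iff Aut_D(1))
  then have "linear (\<lambda>x. f x - x)"
    using linear_compose_sub[OF \<open>linear f\<close> linear_ident] by simp
  then have "pr i (f x - x) = (\<Sum>k\<in>{k. pr k x \<noteq> 0}. pr i (f (pr k x) - pr k x))"
    by (rule pr_linear_expand[OF _ finite_pr order_refl])
  also have "\<dots> = 0"
  proof (rule sum.neutral, rule ballI)
    fix k assume "k \<in> {k. pr k x \<noteq> 0}"
    then have "k \<le> i"
      using x[of k] \<open>i \<ge> n\<close> by force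
    then show "pr i (f (pr k x) - pr k x) = 0"
      using f pr_in[of k x] unfolding Aut_minus_iff by blast
  qed
  finally show ?thesis .
qed

lemma Aut_minus_comp:
  assumes f: "f \<in> Aut_minus Y vac V" and g: "g \<in> Aut_minus Y vac V"
  shows "f \<circ> g \<in> Aut_minus Y vac V"
  unfolding Aut_minus_iff
proof (intro conjI allI ballI impI)
  show "f \<circ> g \<in> Aut Y vac"
    using f g by (simp add: Aut_minus_iff Aut_comp)
next
  fix n v i assume v: "v \<in> V n" and i: "n \<le> i"
  have g': "pr j (g v - v) = 0" if "j \<ge> n" for j
    using g v that by (simp add: Aut_minus_iff)
  have "pr j (g v) = 0" if "j > n" for j
    using g'[of j] that by (simp add: pr_linear_simps pr_homogeneous[OF v])
  then have "pr i (f (g v) - g v) = 0"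
    by (rule Aut_minus_lower[OF f _ i])
  with g'[OF i] show "pr i ((f \<circ> g) v - v) = 0"
    by (simp add: pr_linear_simps)
qed

lemma Aut_minus_inv:
  assumes f: "f \<in> Aut_minus Y vac V"
  shows "inv_into UNIV f \<in> Aut_minus Y vac V"
  unfolding Aut_minus_iff
proof (intro conjI allI ballI impI)
  have fA: "f \<in> Aut Y vac"
    using f by (simp add: Aut_minus_iff)
  then show "inv_into UNIV f \<in> Aut Y vac"
    by (rule Aut_inv)
  fix n v i assume v: "v \<in> V n" and i: "n \<le> i"
  define y where "y = inv_into UNIV f v"
  have fy: "f y = v"
    using Aut_D(2)[OF fA] by (simp add: y_def bij_is_surj surj_f_inv_f)
  \<comment> \<open>The highest component of \<open>y\<close> survives in \<open>f y = v\<close>, so it has degree at most \<open>n\<close>.\<close>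
  have low: "pr j y = 0" if "j > n" for j
  proof (rule ccontr)
    assume "pr j y \<noteq> 0"
    define k where "k = Max {k. pr k y \<noteq> 0}"
    have "pr k y \<noteq> 0" "j \<le> k"
      using Max_in[OF finite_pr[of y]] Max_ge[OF finite_pr[of y], of j] \<open>pr j y \<noteq> 0\<close>
      by (auto simp: k_def)
    moreover have "pr i y = 0" if "i > k" for i
      using Max_ge[OF finite_pr[of y], of i] that by (force simp: k_def)
    then have "pr k (f y - y) = 0"
      by (rule Aut_minus_lower[OF f _ order_refl])
    ultimately show False
      using \<open>j > n\<close> by (simp add: fy pr_linear_simps pr_homogeneous[OF v])
  qed
  have "pr i (f y - y) = 0"
    by (rule Aut_minus_lower[OF f low i])
  then show "pr i (inv_into UNIV f v - v) = 0"
    by (simp add: fy pr_linear_simps flip: y_def)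
qed

lemma id_Aut_minus: "id \<in> Aut_minus Y vac V"
  by (simp add: Aut_minus_iff Aut_id pr_linear_simps)

end

context conformal_vertex_algebra
begin

lemma Aut_fix_in_V:
  assumes "f \<in> Aut_fix Y vac \<omega>" "v \<in> V n"
  shows "f v \<in> V n"
proof -
  have f: "f \<in> Aut Y vac" "f \<omega> = \<omega>"
    using assms(1) by (auto simp: Aut_fix_def)
  have "Y \<omega> 1 (f v) = f (Y \<omega> 1 v)"
    by (simp add: Aut_D(3)[OF f(1)] f(2))
  then show ?thesis
    by (simp add: in_V_iff omega_1[OF assms(2)] linear_scale[OF Aut_D(1)[OF f(1)]])
qed

lemma Aut_fix_comp:
  "f \<in> Aut_fix Y vac \<omega> \<Longrightarrow> g \<in> Aut_fix Y vac \<omega> \<Longrightarrow> f \<circ> g \<in> Aut_fix Y vac \<omega>"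
  by (auto simp: Aut_fix_def Aut_comp)

lemma Aut_fix_inv:
  assumes "f \<in> Aut_fix Y vac \<omega>"
  shows "inv_into UNIV f \<in> Aut_fix Y vac \<omega>"
  using assms Aut_inv[of f] Aut_D(2)[of f] by (auto simp: Aut_fix_def bij_is_inj intro: inv_f_eq)

lemma id_Aut_fix: "id \<in> Aut_fix Y vac \<omega>"
  by (simp add: Aut_fix_def Aut_id)

lemma Aut_minus_Int_Aut_fix: "Aut_minus Y vac V \<inter> Aut_fix Y vac \<omega> = {id}"
proof -
  have "f = id" if f: "f \<in> Aut_minus Y vac V" "f \<in> Aut_fix Y vac \<omega>" for f
  proof
    fix v
    have "linear f"
      using f(1) by (simp add: Aut_minus_iff Aut_D(1))
    show "f v = id v"
    proof (rule linear_eq_on_homogeneous[OF \<open>linear f\<close> linear_id])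
      fix m v assume v: "v \<in> V m"
      have "pr m (f v - v) = 0"
        using f(1) v by (simp add: Aut_minus_iff)
      then show "f v = id v"
        by (simp add: pr_linear_simps pr_homogeneous[OF v] pr_homogeneous[OF Aut_fix_in_V[OF f(2) v]])
    qed
  qed
  then show ?thesis
    using id_Aut_minus id_Aut_fix by auto
qed

lemma Aut_minus_conj_Aut_fix:
  assumes h: "h \<in> Aut_fix Y vac \<omega>" and g: "g \<in> Aut_minus Y vac V"
  shows "h \<circ> g \<circ> inv_into UNIV h \<in> Aut_minus Y vac V"
  unfolding Aut_minus_iff
proof (intro conjI allI ballI impI)
  have hA: "h \<in> Aut Y vac" and gA: "g \<in> Aut Y vac"
    using h g by (auto simp: Aut_fix_def Aut_minus_iff)
  then show "h \<circ> g \<circ> inv_into UNIV h \<in> Aut Y vac"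
    by (intro Aut_comp Aut_inv)
  fix n v i assume v: "v \<in> V n" and i: "n \<le> i"
  define u where "u = inv_into UNIV h v"
  have u: "u \<in> V n"
    unfolding u_def by (rule Aut_fix_in_V[OF Aut_fix_inv[OF h] v])
  have hu: "h u = v"
    using Aut_D(2)[OF hA] by (simp add: u_def bij_is_surj surj_f_inv_f)
  have "pr i (h (g u - u)) = h (pr (i - 0) (g u - u))"
    by (rule pr_shift[OF Aut_D(1)[OF hA]]) (simp add: Aut_fix_in_V[OF h])
  also have "\<dots> = 0"
    using g u i by (simp add: Aut_minus_iff linear_0[OF Aut_D(1)[OF hA]])
  finally show "pr i ((h \<circ> g \<circ> inv_into UNIV h) v - v) = 0"
    by (simp add: linear_diff[OF Aut_D(1)[OF hA]] hu flip: u_def)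
qed

end

context positive_voa
begin

text \<open>If \<open>f \<omega> = exp(a(1)) (\<omega> + T b)\<close>, then \<open>h = exp(a(1))\<^sup>-\<^sup>1 f\<close> preserves the grading and
  conjugates \<open>L(1)\<close> to \<open>L(1) - 2 b(1)\<close>. Both operators vanish on \<open>V\<^sub>1\<close>, so \<open>b(1)b = 0\<close>, and \<open>b = 0\<close>
  since the form is definite.\<close>

lemma Aut_factorization:
  assumes f: "f \<in> Aut Y vac"
  obtains g h where "g \<in> Aut_minus Y vac V" "h \<in> Aut_fix Y vac \<omega>" "f = g \<circ> h"
proof -
  obtain a b where a: "a \<in> J1 Y V" and b: "b \<in> J1 Y V"
    and fw: "f \<omega> = (1 / 2) *\<^sub>R Y a 1 a + a + \<omega> + T b"
    using CV_classification[OF Aut_omega_in_CV[OF f]] .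
  define g where "g = expD (Y a 1)"
  have gA: "g \<in> Aut Y vac"
    unfolding g_def by (rule expD_J1_Aut[OF a])
  have g: "g \<in> Aut_minus Y vac V"
    using gA pr_expD_J1[OF a] by (simp add: Aut_minus_iff g_def)
  define h where "h = inv_into UNIV g \<circ> f"
  have hA: "h \<in> Aut Y vac"
    unfolding h_def by (intro Aut_comp Aut_inv gA f)
  note h = Aut_D[OF hA]
  have gh: "f = g \<circ> h"
    using Aut_D(2)[OF gA] by (auto simp: h_def bij_is_surj surj_f_inv_f)
  have "f \<omega> = g (\<omega> + T b)"
    by (simp add: fw g_def expD_J1_omega_plus_T[OF a b])
  then have hw: "h \<omega> = \<omega> + T b"
    using Aut_D(2)[OF gA] by (simp add: h_def bij_is_inj)
  define u where "u = inv_into UNIV h b"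
  have hu: "h u = b"
    using h(2) by (simp add: u_def bij_is_surj surj_f_inv_f)
  have "h (Y \<omega> 1 u) = h u"
    using J1_D[OF b] by (simp add: h(3) hw Y_omega_plus_T hu omega_1)
  then have "Y \<omega> 1 u = u"
    using h(2) by (meson bij_is_inj inj_eq)
  then have "u \<in> V 1"
    by (simp add: in_V_iff)
  then have "h (Y \<omega> 2 u) = 0"
    by (simp add: omega_2_V1 linear_0[OF h(1)])
  then have "Y b 1 b = 0"
    using omega_2_V1[OF J1_D(1)[OF b]] by (simp add: h(3) hw Y_omega_plus_T hu)
  then have "b = 0"
    using two_point_eq_0[OF J1_D(1)[OF b]] by (simp add: B_simps)
  then have "h \<omega> = \<omega>"
    by (simp add: hw linear_0[OF linear_T])
  with hA have "h \<in> Aut_fix Y vac \<omega>"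
    by (simp add: Aut_fix_def)
  with g gh show ?thesis
    using that by blast
qed

lemma Aut_minus_conj:
  assumes f: "f \<in> Aut Y vac" and n: "n \<in> Aut_minus Y vac V"
  shows "f \<circ> n \<circ> inv_into UNIV f \<in> Aut_minus Y vac V"
proof -
  obtain g h where g: "g \<in> Aut_minus Y vac V" and h: "h \<in> Aut_fix Y vac \<omega>" and fgh: "f = g \<circ> h"
    using Aut_factorization[OF f] .
  have "bij g" "bij h"
    using g h Aut_D(2) by (auto simp: Aut_minus_iff Aut_fix_def)
  then have "f \<circ> n \<circ> inv_into UNIV f = g \<circ> (h \<circ> n \<circ> inv_into UNIV h) \<circ> inv_into UNIV g"
    by (simp add: fgh o_inv_distrib o_assoc)
  then show ?thesis
    using Aut_minus_comp[OF Aut_minus_comp[OF g Aut_minus_conj_Aut_fix[OF h n]] Aut_minus_inv[OF g]]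
    by simp
qed

end

lemma (in vertex_algebra) group_Aut_group:
  shows "group (Aut_group Y vac)"
    and "f \<in> Aut Y vac \<Longrightarrow> inv\<^bsub>Aut_group Y vac\<^esub> f = inv_into UNIV f"
proof -
  have inv: "inv_into UNIV f \<circ> f = id" if "f \<in> Aut Y vac" for f
    using Aut_D(2)[OF that] by (simp add: bij_is_inj)
  show G: "group (Aut_group Y vac)"
  proof (rule groupI)
    fix f assume "f \<in> carrier (Aut_group Y vac)"
    then show "\<exists>g\<in>carrier (Aut_group Y vac). g \<otimes>\<^bsub>Aut_group Y vac\<^esub> f = \<one>\<^bsub>Aut_group Y vac\<^esub>"
      using Aut_inv inv by (auto simp: Aut_group_def)
  qed (auto simp: Aut_group_def Aut_comp Aut_id o_assoc)
  show "inv\<^bsub>Aut_group Y vac\<^esub> f = inv_into UNIV f" if "f \<in> Aut Y vac"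
    by (rule group.inv_equality[OF G]) (use that Aut_inv inv in \<open>auto simp: Aut_group_def\<close>)
qed

lemma (in positive_voa) Aut_semidirect_product:
  "internal_semidirect_product (Aut_group Y vac) (Aut_minus Y vac V) (Aut_fix Y vac \<omega>)"
proof -
  let ?G = "Aut_group Y vac"
  interpret G: group ?G
    by (rule group_Aut_group)
  have G: "carrier ?G = Aut Y vac" "\<one>\<^bsub>?G\<^esub> = id" "f \<otimes>\<^bsub>?G\<^esub> g = f \<circ> g" for f g
    by (simp_all add: Aut_group_def)
  have minus: "Aut_minus Y vac V \<subseteq> Aut Y vac" and fx: "Aut_fix Y vac \<omega> \<subseteq> Aut Y vac"
    by (auto simp: Aut_minus_def Aut_fix_def)
  have N: "subgroup (Aut_minus Y vac V) ?G"
  proof (rule subgroup.intro)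
    fix f assume "f \<in> Aut_minus Y vac V"
    then show "inv\<^bsub>?G\<^esub> f \<in> Aut_minus Y vac V"
      using Aut_minus_inv group_Aut_group(2) minus by fastforce
  qed (use minus in \<open>auto simp: G Aut_minus_comp id_Aut_minus\<close>)
  have H: "subgroup (Aut_fix Y vac \<omega>) ?G"
  proof (rule subgroup.intro)
    fix f assume "f \<in> Aut_fix Y vac \<omega>"
    then show "inv\<^bsub>?G\<^esub> f \<in> Aut_fix Y vac \<omega>"
      using Aut_fix_inv group_Aut_group(2) fx by fastforce
  qed (use fx in \<open>auto simp: G Aut_fix_comp id_Aut_fix\<close>)
  have "Aut_minus Y vac V \<lhd> ?G"
    by (rule G.normal_invI[OF N]) (use Aut_minus_conj in \<open>auto simp: G group_Aut_group(2)\<close>)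
  moreover have "Aut_minus Y vac V <#>\<^bsub>?G\<^esub> Aut_fix Y vac \<omega> = carrier ?G"
  proof
    show "Aut_minus Y vac V <#>\<^bsub>?G\<^esub> Aut_fix Y vac \<omega> \<subseteq> carrier ?G"
      using minus fx Aut_comp by (auto simp: set_mult_def G)
    show "carrier ?G \<subseteq> Aut_minus Y vac V <#>\<^bsub>?G\<^esub> Aut_fix Y vac \<omega>"
    proof
      fix f assume "f \<in> carrier ?G"
      then obtain g h where "g \<in> Aut_minus Y vac V" "h \<in> Aut_fix Y vac \<omega>" "f = g \<circ> h"
        using Aut_factorization by (auto simp: G)
      then show "f \<in> Aut_minus Y vac V <#>\<^bsub>?G\<^esub> Aut_fix Y vac \<omega>"
        by (auto simp: set_mult_def G)
    qed
  qed
  ultimately show ?thesis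
    using H Aut_minus_Int_Aut_fix by (simp add: internal_semidirect_product_def G)
qed

theorem theorem7p1:
  fixes Y :: "'v::real_vector \<Rightarrow> int \<Rightarrow> 'v \<Rightarrow> 'v"
    and vac :: 'v
    and V :: "int \<Rightarrow> 'v set"
    and \<omega> :: 'v
    and B :: "'v \<Rightarrow> 'v \<Rightarrow> real"
  assumes "voa_strong_CFT_type Y vac V \<omega>"
    and "simple_va Y"
    and "invariant_form Y V \<omega> B"
    and "B vac vac = 1"
    and "positive_definite B"
  shows "CV Y vac =
           {(1 / 2) *\<^sub>R Y a 1 a + a + \<omega> + translation Y vac b | a b. a \<in> J1 Y V \<and> b \<in> J1 Y V}
         \<and> internal_semidirect_product (Aut_group Y vac) (Aut_minus Y vac V) (Aut_fix Y vac \<omega>)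
         \<and> (J1 Y V = {0} \<longrightarrow> CV Y vac = {\<omega>} \<and> Aut Y vac = Aut_fix Y vac \<omega>)"
proof -
  interpret positive_voa Y vac V \<omega> B
    using assms by (simp add: positive_voa_def positive_voa_axioms_def)
  have CV: "CV Y vac =
      {(1 / 2) *\<^sub>R Y a 1 a + a + \<omega> + translation Y vac b | a b. a \<in> J1 Y V \<and> b \<in> J1 Y V}"
    using J1_in_CV by (blast elim: CV_classification)
  have "CV Y vac = {\<omega>} \<and> Aut Y vac = Aut_fix Y vac \<omega>" if "J1 Y V = {0}"
  proof
    show "CV Y vac = {\<omega>}"
      unfolding CV that by (auto simp: linear_0[OF linear_T])
    then show "Aut Y vac = Aut_fix Y vac \<omega>"
      using Aut_omega_in_CV by (auto simp: Aut_fix_def)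
  qed
  with CV Aut_semidirect_product show ?thesis
    by blast
qed

end
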